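(* Let $m$ be a positive integer. Every linear isotope of a cyclic group of order $m$ is isomorphic to exactly one isotope $(\mathbb{Z}_m;\circ)=(\alpha,\beta,d)$, i.e. $x\circ y=\alpha\cdot x+\beta\cdot y+d$, where $\alpha,\beta\in\mathbb{Z}_m^{*}$ and $d$ is a (positive) common divisor of $m$ and $\alpha+\beta-1$. Moreover, such an isotope $(\alpha,\beta,d)$ - is strictly commutative (symmetry group $\{\iota,s\}$) if and only if $\beta=\alpha\neq-1$; - is strictly left symmetric (symmetry group $\{\iota,r\}$) if and only if $\beta=-1\neq\alpha$; - is strictly right symmetric (symmetry group $\{\iota,\ell\}$) if and only if $\alpha=-1\neq\beta$; - is strictly semi-symmetric (symmetry group $A_3$) if and only if $\alpha\neq-1$, $\beta=\alpha^{-1}$, $\alpha^3=-1$ and $\alpha d=-d$; - is totally symmetric (symmetry group $S_3$) if and only if $\alpha=\beta=-1$; - is asymmetric (symmetry group $\{\iota\}$) if and only if the three inequalities $\alpha\neq-1$, $\alpha\neq\beta$, $\beta\neq-1$ all hold and ($\beta\neq\alpha^{-1}$ or $\alpha^3\neq-1$ or $\alpha d\neq-d$). All equalities and inequalities in this list are in $\mathbb{Z}_m$.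
   Context: $\mathbb{Z}_m$ is the ring of integers modulo $m$, $\mathbb{Z}_m^{*}$ its group of invertible elements. In the expression $x\circ y=\alpha x+\beta y+d$ the divisor $d$ is read modulo $m$ (so $d=m$ gives the element $0$), and common divisors of $m$ and $\alpha+\beta-1$ are taken for any integer representative of $\alpha+\beta-1$. A linear isotope of a group $(Q;+)$ is a quasigroup $(Q;\cdot)$ of the form $x\cdot y=\varphi x+c+\psi y$ with $\varphi,\psi$ automorphisms of $(Q;+)$ and $c\in Q$. For $\sigma\in S_3$, the $\sigma$-parastrophe of a quasigroup operation $(\cdot)$ is defined by $x_{1\sigma}\stackrel{\sigma}{\cdot}x_{2\sigma}=x_{3\sigma}\Leftrightarrow x_1\cdot x_2=x_3$; the symmetry group is $\mathrm{Sym}(\cdot)=\{\sigma\in S_3:(\stackrel{\sigma}{\cdot})=(\cdot)\}$. Put $s=(12)$, $\ell=(13)$, $r=(23)$, $\iota$ the identity of $S_3$. A quasigroup is commutative if $s\in\mathrm{Sym}(\cdot)$ ($xy=yx$); left symmetric if $r\in\mathrm{Sym}(\cdot)$ ($x\cdot xy=y$); right symmetric if $\ell\in\mathrm{Sym}(\cdot)$ ($xy\cdot y=x$); semi-symmetric if $\mathrm{Sym}(\cdot)\supseteq A_3$ ($x\cdot yx=y$); totally symmetric if $\mathrm{Sym}(\cdot)=S_3$; asymmetric if $\mathrm{Sym}(\cdot)=\{\iota\}$. "Strictly" means: has the property but is not totally symmetric. *)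

theory Defs
  imports "HOL-Algebra.Algebra"
begin

section \<open>Quasigroups, parastrophes and symmetry groups\<close>

definition quasigroup :: "'a set \<Rightarrow> ('a \<Rightarrow> 'a \<Rightarrow> 'a) \<Rightarrow> bool" where
  "quasigroup Q f \<longleftrightarrow>
     (\<forall>x\<in>Q. \<forall>y\<in>Q. f x y \<in> Q) \<and>
     (\<forall>a\<in>Q. \<forall>b\<in>Q. \<exists>!x. x \<in> Q \<and> f x a = b) \<and>
     (\<forall>a\<in>Q. \<forall>b\<in>Q. \<exists>!y. y \<in> Q \<and> f a y = b)"

definition quasigroup_isomorphic ::
  "'a set \<Rightarrow> ('a \<Rightarrow> 'a \<Rightarrow> 'a) \<Rightarrow> 'b set \<Rightarrow> ('b \<Rightarrow> 'b \<Rightarrow> 'b) \<Rightarrow> bool" where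
  "quasigroup_isomorphic Q f Q' f' \<longleftrightarrow>
     (\<exists>h. bij_betw h Q Q' \<and> (\<forall>x\<in>Q. \<forall>y\<in>Q. h (f x y) = f' (h x) (h y)))"

text \<open>A permutation \<open>\<sigma>\<close> of \<open>{1..3}\<close> acts on indices, so \<open>x (\<sigma> i)\<close> is the entry written
  \<open>x\<close> with subscript \<open>i\<sigma>\<close>.  The lemma \<open>parastrophe_iff\<close> below gives the usual defining
  equivalence.\<close>

definition parastrophe ::
  "'a set \<Rightarrow> ('a \<Rightarrow> 'a \<Rightarrow> 'a) \<Rightarrow> (nat \<Rightarrow> nat) \<Rightarrow> 'a \<Rightarrow> 'a \<Rightarrow> 'a" where
  "parastrophe Q f \<sigma> a b =
     (THE c. \<exists>x\<in>{1..3} \<rightarrow> Q. x (\<sigma> 1) = a \<and> x (\<sigma> 2) = b \<and> x (\<sigma> 3) = c \<and> f (x 1) (x 2) = x 3)"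

definition Sym :: "'a set \<Rightarrow> ('a \<Rightarrow> 'a \<Rightarrow> 'a) \<Rightarrow> (nat \<Rightarrow> nat) set" where
  "Sym Q f =
     {\<sigma> \<in> carrier (sym_group 3). \<forall>a\<in>Q. \<forall>b\<in>Q. parastrophe Q f \<sigma> a b = f a b}"

abbreviation perm_s :: "nat \<Rightarrow> nat" where "perm_s \<equiv> transpose 1 2"
abbreviation perm_l :: "nat \<Rightarrow> nat" where "perm_l \<equiv> transpose 1 3"
abbreviation perm_r :: "nat \<Rightarrow> nat" where "perm_r \<equiv> transpose 2 3"

definition commutative_qg :: "'a set \<Rightarrow> ('a \<Rightarrow> 'a \<Rightarrow> 'a) \<Rightarrow> bool" where
  "commutative_qg Q f \<longleftrightarrow> perm_s \<in> Sym Q f"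

definition left_symmetric :: "'a set \<Rightarrow> ('a \<Rightarrow> 'a \<Rightarrow> 'a) \<Rightarrow> bool" where
  "left_symmetric Q f \<longleftrightarrow> perm_r \<in> Sym Q f"

definition right_symmetric :: "'a set \<Rightarrow> ('a \<Rightarrow> 'a \<Rightarrow> 'a) \<Rightarrow> bool" where
  "right_symmetric Q f \<longleftrightarrow> perm_l \<in> Sym Q f"

definition semi_symmetric :: "'a set \<Rightarrow> ('a \<Rightarrow> 'a \<Rightarrow> 'a) \<Rightarrow> bool" where
  "semi_symmetric Q f \<longleftrightarrow> carrier (alt_group 3) \<subseteq> Sym Q f"

definition totally_symmetric :: "'a set \<Rightarrow> ('a \<Rightarrow> 'a \<Rightarrow> 'a) \<Rightarrow> bool" where
  "totally_symmetric Q f \<longleftrightarrow> Sym Q f = carrier (sym_group 3)"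

definition asymmetric_qg :: "'a set \<Rightarrow> ('a \<Rightarrow> 'a \<Rightarrow> 'a) \<Rightarrow> bool" where
  "asymmetric_qg Q f \<longleftrightarrow> Sym Q f = {id}"

definition strictly ::
  "('a set \<Rightarrow> ('a \<Rightarrow> 'a \<Rightarrow> 'a) \<Rightarrow> bool) \<Rightarrow> 'a set \<Rightarrow> ('a \<Rightarrow> 'a \<Rightarrow> 'a) \<Rightarrow> bool" where
  "strictly P Q f \<longleftrightarrow> P Q f \<and> \<not> totally_symmetric Q f"


section \<open>Linear isotopes\<close>

definition linear_isotope :: "('a, 'b) monoid_scheme \<Rightarrow> ('a \<Rightarrow> 'a \<Rightarrow> 'a) \<Rightarrow> bool" where
  "linear_isotope G f \<longleftrightarrow>
     quasigroup (carrier G) f \<and>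
     (\<exists>\<phi>\<in>iso G G. \<exists>\<psi>\<in>iso G G. \<exists>c\<in>carrier G.
        \<forall>x\<in>carrier G. \<forall>y\<in>carrier G. f x y = \<phi> x \<otimes>\<^bsub>G\<^esub> c \<otimes>\<^bsub>G\<^esub> \<psi> y)"

text \<open>The ring of integers modulo \<open>m\<close> is \<open>ZFact\<close>, whose elements are cosets.  Unlike
  \<open>residue_ring\<close>, it is a ring with the correct unit also for \<open>m = 1\<close>.\<close>

abbreviation Zmod :: "nat \<Rightarrow> int set ring" where
  "Zmod m \<equiv> ZFact (int m)"

definition residue_class :: "nat \<Rightarrow> int \<Rightarrow> int set" where
  "residue_class m k = Idl\<^bsub>\<Z>\<^esub> {int m} +>\<^bsub>\<Z>\<^esub> k"

definition cyclic_isotope_op ::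
  "nat \<Rightarrow> int set \<Rightarrow> int set \<Rightarrow> nat \<Rightarrow> int set \<Rightarrow> int set \<Rightarrow> int set" where
  "cyclic_isotope_op m \<alpha> \<beta> d x y =
     \<alpha> \<otimes>\<^bsub>Zmod m\<^esub> x \<oplus>\<^bsub>Zmod m\<^esub> \<beta> \<otimes>\<^bsub>Zmod m\<^esub> y \<oplus>\<^bsub>Zmod m\<^esub> residue_class m (int d)"

text \<open>An element of \<open>Zmod m\<close> is the set of its integer representatives, so \<open>k\<close> below ranges
  over the representatives of \<open>\<alpha> + \<beta> - 1\<close>.\<close>

definition canonical_triples :: "nat \<Rightarrow> (int set \<times> int set \<times> nat) set" where
  "canonical_triples m =
     {(\<alpha>, \<beta>, d). \<alpha> \<in> Units (Zmod m) \<and> \<beta> \<in> Units (Zmod m) \<and> 0 < d \<and> d dvd m \<and>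
        (\<forall>k \<in> \<alpha> \<oplus>\<^bsub>Zmod m\<^esub> \<beta> \<ominus>\<^bsub>Zmod m\<^esub> \<one>\<^bsub>Zmod m\<^esub>. int d dvd k)}"


section \<open>The defining property of parastrophes\<close>

lemma quasigroup_graph_unique:
  assumes "quasigroup Q f" "x \<in> {1..3} \<rightarrow> Q" "y \<in> {1..3} \<rightarrow> Q"
    and "f (x 1) (x 2) = x 3" "f (y 1) (y 2) = y 3"
    and "i \<in> {1..3::nat}" "\<And>j. j \<in> {1..3} \<Longrightarrow> j \<noteq> i \<Longrightarrow> x j = y j"
  shows "x i = y i"
proof -
  have Q: "x 1 \<in> Q" "x 2 \<in> Q" "x 3 \<in> Q" "y 1 \<in> Q" "y 2 \<in> Q" "y 3 \<in> Q"
    using assms(2,3) by (auto simp: Pi_iff)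
  consider "i = 1" | "i = 2" | "i = 3" using assms(6) by fastforce
  then show ?thesis
  proof cases
    case 1
    then have "f (y 1) (x 2) = x 3" using assms(5,7) by auto
    then show ?thesis using 1 assms(1,4) Q unfolding quasigroup_def by blast
  next
    case 2
    then have "f (x 1) (y 2) = x 3" using assms(5,7) by auto
    then show ?thesis using 2 assms(1,4) Q unfolding quasigroup_def by blast
  next
    case 3
    then have "x 1 = y 1" "x 2 = y 2" using assms(7) by auto
    then show ?thesis using 3 assms(4,5) by simp
  qed
qed

lemma quasigroup_graph_exists:
  assumes "quasigroup Q f" "x \<in> {1..3} \<rightarrow> Q" "i \<in> {1..3::nat}"
  shows "\<exists>y\<in>{1..3} \<rightarrow> Q. f (y 1) (y 2) = y 3 \<and> (\<forall>j. j \<noteq> i \<longrightarrow> y j = x j)"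
proof -
  have Q: "x 1 \<in> Q" "x 2 \<in> Q" "x 3 \<in> Q"
    using assms(2) by (auto simp: Pi_iff)
  have "\<exists>z\<in>Q. f ((x(i := z)) 1) ((x(i := z)) 2) = (x(i := z)) 3"
  proof -
    have sol: "\<exists>z\<in>Q. f z (x 2) = x 3" "\<exists>z\<in>Q. f (x 1) z = x 3" "f (x 1) (x 2) \<in> Q"
      using assms(1) Q unfolding quasigroup_def by meson+
    consider "i = 1" | "i = 2" | "i = 3" using assms(3) by fastforce
    then show ?thesis
      using sol by cases simp_all
  qed
  then obtain z where z: "z \<in> Q" "f ((x(i := z)) 1) ((x(i := z)) 2) = (x(i := z)) 3"
    by blast
  show ?thesis
    by (rule bexI[of _ "x(i := z)"]) (use z assms(2) in \<open>auto simp: Pi_iff\<close>)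
qed

lemma parastrophe_iff:
  assumes Q: "quasigroup Q f" and \<sigma>: "\<sigma> \<in> carrier (sym_group 3)" and x: "x \<in> {1..3} \<rightarrow> Q"
  shows "parastrophe Q f \<sigma> (x (\<sigma> 1)) (x (\<sigma> 2)) = x (\<sigma> 3) \<longleftrightarrow> f (x 1) (x 2) = x 3"
proof -
  have perm: "\<sigma> permutes {1..3}" using \<sigma> by (simp add: sym_group_def)
  have in3: "\<sigma> 1 \<in> {1..3}" "\<sigma> 2 \<in> {1..3}" "\<sigma> 3 \<in> {1..3}"
    using permutes_in_image[OF perm] by auto
  have neq: "\<sigma> 1 \<noteq> \<sigma> 3" "\<sigma> 2 \<noteq> \<sigma> 3"
    by (simp_all add: inj_eq[OF permutes_inj[OF perm]])
  have cover: "j = \<sigma> 1 \<or> j = \<sigma> 2" if "j \<in> {1..3}" "j \<noteq> \<sigma> 3" for j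
  proof -
    have "j \<in> \<sigma> ` {1..3}" using that(1) by (simp only: permutes_image[OF perm])
    then obtain i where "i \<in> {1..3}" "j = \<sigma> i" by (rule imageE)
    moreover have "i \<noteq> 3" using that(2) \<open>j = \<sigma> i\<close> by blast
    ultimately have "i = 1 \<or> i = 2" by simp linarith
    then show ?thesis using \<open>j = \<sigma> i\<close> by blast
  qed
  obtain y where y: "y \<in> {1..3} \<rightarrow> Q" "f (y 1) (y 2) = y 3" "\<And>j. j \<noteq> \<sigma> 3 \<Longrightarrow> y j = x j"
    using quasigroup_graph_exists[OF Q x in3(3)] by blast
  have uniq: "z (\<sigma> 3) = y (\<sigma> 3)"
    if "z \<in> {1..3} \<rightarrow> Q" "f (z 1) (z 2) = z 3" "z (\<sigma> 1) = x (\<sigma> 1)" "z (\<sigma> 2) = x (\<sigma> 2)" for z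
    by (rule quasigroup_graph_unique[OF Q that(1) y(1) that(2) y(2) in3(3)])
       (use cover that(3,4) y(3) in metis)
  have "parastrophe Q f \<sigma> (x (\<sigma> 1)) (x (\<sigma> 2)) = y (\<sigma> 3)"
    unfolding parastrophe_def
  proof (rule the_equality)
    show "\<exists>z\<in>{1..3} \<rightarrow> Q. z (\<sigma> 1) = x (\<sigma> 1) \<and> z (\<sigma> 2) = x (\<sigma> 2) \<and> z (\<sigma> 3) = y (\<sigma> 3) \<and>
            f (z 1) (z 2) = z 3"
      using y neq by blast
  qed (use uniq in metis)
  moreover have "y (\<sigma> 3) = x (\<sigma> 3) \<longleftrightarrow> f (x 1) (x 2) = x 3"
  proof
    assume "y (\<sigma> 3) = x (\<sigma> 3)"
    then have "y j = x j" for j using y(3) by metis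
    then show "f (x 1) (x 2) = x 3" using y(2) by simp
  qed (use uniq x in metis)
  ultimately show ?thesis by simp
qed

end

(* A generator g identifies the cyclic group with the integers modulo m through exponents, and a
   linear isotope becomes (i, j) -> a i + b j + c with a, b units. An isomorphism between two such
   operations is itself affine, i -> u i + t with u a unit, since its increments are constant; it
   therefore preserves a and b and replaces c by u c - (a + b - 1) t. The orbits of c under these
   substitutions correspond to the values of gcd(c, m, a + b - 1), because a unit modulo a divisor
   of m lifts to a unit modulo m. The symmetries are read off by evaluating the parastrophic
   identities at (0,0), (1,0) and (0,1). *)

theory Submission
  imports Defs "HOL-Number_Theory.Cong"
begin

text \<open>Every operation is pulled back to the integers along a map \<open>e\<close> whose fibres
  are the congruence classes modulo \<open>m\<close>; powers of a generator and cosets in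
  \<open>Zmod m\<close> thus fall under the same lemmas, with congruence as the only relation.
  Modulo \<open>m\<close>, the numbers (a + b - 1) t are exactly the multiples of gcd(m, a + b - 1).
  The shift t therefore leaves a congruence for u c modulo that gcd only, whereas u must be coprime
  to all of \<open>m\<close>: this gap is what the lifting of units closes. Isomorphism with a
  canonical triple is characterised by equations that determine the triple, so existence and
  uniqueness come out of one equivalence. For the symmetries there are four conditions, one for each
  transposition and one shared by both three-cycles. Any two of them force the others, and for this
  reason having a property strictly is the same as having precisely the listed symmetry
  group.\<close>

section \<open>Units modulo m and the orbits of the constant term\<close>

text \<open>The witness is u + k n, where k collects the primes of m that do not divide u. A prime
  of m dividing u divides neither k nor n; a prime of m not dividing u divides k. Either way it
  divides exactly one of the two summands.\<close>

lemma lift_unit_mod: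
  fixes u n :: int and m :: int
  assumes m: "m \<noteq> 0" and u: "coprime u n"
  shows "\<exists>v. coprime v m \<and> [v = u] (mod n)"
proof -
  define k where "k = \<Prod>{p \<in> prime_factors m. \<not> p dvd u}"
  have fin: "finite {p \<in> prime_factors m. \<not> p dvd u}" by simp
  have "coprime (u + k * n) m"
  proof (rule ccontr)
    assume "\<not> coprime (u + k * n) m"
    then obtain p where p: "Factorial_Ring.prime p" "p dvd u + k * n" "p dvd m"
    proof -
      assume hyp: "\<And>p. \<lbrakk>Factorial_Ring.prime p; p dvd u + k * n; p dvd m\<rbrakk> \<Longrightarrow> thesis"
      have "gcd (u + k * n) m \<noteq> 0" "\<not> is_unit (gcd (u + k * n) m)"
        using m \<open>\<not> coprime (u + k * n) m\<close> by (auto simp: coprime_iff_gcd_eq_1)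
      then obtain p where "Factorial_Ring.prime p" "p dvd gcd (u + k * n) m"
        using prime_divisor_exists by blast
      then show thesis using hyp by simp
    qed
    show False
    proof (cases "p dvd u")
      case True
      then have "p dvd k * n" using p(2) dvd_add_right_iff by blast
      moreover have "\<not> p dvd n" using True u p(1) by (meson coprime_common_divisor not_prime_unit)
      ultimately have "p dvd k" using p(1) prime_dvd_mult_iff by blast
      then obtain q where q: "q \<in> prime_factors m" "\<not> q dvd u" "p dvd q"
        unfolding k_def using prime_dvd_prod_iff[OF fin p(1), of "\<lambda>x. x"] by auto
      then show False using True p(1) primes_dvd_imp_eq[of p q] by auto
    next
      case False
      then have "p dvd k" unfolding k_def
        using p m by (intro dvd_prodI[OF fin, of p "\<lambda>x. x", simplified])
          (simp add: prime_factors_dvd)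
      then show False using False p(2) by (simp add: dvd_add_left_iff)
    qed
  qed
  then show ?thesis by (intro exI[of _ "u + k * n"]) (simp add: cong_def)
qed

text \<open>Divided by the gcd, c becomes invertible modulo g1. Its inverse v is known to be coprime
  to g1 only; lifting replaces it by a congruent u coprime to m.\<close>

lemma unit_multiple_cong_gcd:
  fixes c g m :: int
  assumes m: "m \<noteq> 0" and g: "g \<noteq> 0"
  shows "\<exists>u. coprime u m \<and> [u * c = gcd c g] (mod g)"
proof -
  define d where "d = gcd c g"
  have d: "d \<noteq> 0" using g by (simp add: d_def)
  obtain c1 g1 where c1: "c = c1 * d" "g = g1 * d" "coprime c1 g1"
    unfolding d_def using gcd_coprime_exists[of c g] g by auto
  obtain v where v: "[c1 * v = 1] (mod g1)" using cong_solve_coprime_int[OF c1(3)] by auto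
  then have "coprime v g1" by (metis coprime_iff_invertible_int mult.commute)
  then obtain u where u: "coprime u m" "[u = v] (mod g1)" using lift_unit_mod[OF m] by blast
  have "[u * c1 = 1] (mod g1)" using v u(2) by (metis cong_scalar_left cong_trans mult.commute)
  then have "g1 dvd u * c1 - 1" by (simp add: cong_iff_dvd_diff)
  then have "g1 * d dvd (u * c1 - 1) * d" by (rule mult_dvd_mono) simp
  then have "[u * c = d] (mod g)" by (simp add: c1 cong_iff_dvd_diff algebra_simps)
  then show ?thesis using u(1) unfolding d_def by blast
qed

text \<open>Here n stands for a + b - 1. Eliminating t leaves u c = d modulo gcd(m, n). Then d
  divides c, because u is coprime to the divisor d of m; conversely gcd(c, m, n) divides both u c
  and u c - d.\<close>

lemma affine_shift_solvable_iff:
  fixes m n c :: int and d :: nat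
  assumes m: "m \<noteq> 0" and d: "0 < d" "int d dvd m" "int d dvd n"
  shows "(\<exists>u t. coprime u m \<and> [u * c + t = (n + 1) * t + int d] (mod m))
    \<longleftrightarrow> int d = gcd c (gcd m n)"
proof
  assume "\<exists>u t. coprime u m \<and> [u * c + t = (n + 1) * t + int d] (mod m)"
  then obtain u t where u: "coprime u m" and "m dvd u * c + t - ((n + 1) * t + int d)"
    unfolding cong_iff_dvd_diff by blast
  then have ut: "m dvd u * c - n * t - int d" by (simp add: algebra_simps)
  let ?g = "gcd m n"
  have "?g dvd u * c - n * t - int d" using dvd_trans[OF gcd_dvd1 ut] .
  then have "?g dvd (u * c - int d) - n * t" by (simp add: algebra_simps)
  moreover have "?g dvd n * t" by simp
  ultimately have "?g dvd (u * c - int d - n * t) + n * t" by (rule dvd_add)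
  then have *: "?g dvd u * c - int d" by (simp only: diff_add_cancel)
  have dg: "int d dvd ?g" using d(2,3) by (rule gcd_greatest)
  have "int d dvd u * c" 
    using dvd_add[OF dvd_trans[OF dg *] dvd_refl] by (simp only: diff_add_cancel)
  moreover have "coprime (int d) u" 
    using coprime_divisors[OF d(2) dvd_refl[of u]] u by (simp add: coprime_commute)
  ultimately have 1: "int d dvd gcd c ?g" using dg by (metis coprime_dvd_mult_right_iff gcd_greatest)
  have "gcd c ?g dvd u * c - int d" using dvd_trans[OF gcd_dvd2 *] .
  moreover have "gcd c ?g dvd u * c" using gcd_dvd1 by (rule dvd_mult)
  ultimately have "gcd c ?g dvd u * c - (u * c - int d)" by (rule dvd_diff[rotated])
  then have "gcd c ?g dvd int d" by (simp only: diff_diff_eq2 add_diff_cancel_left')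
  then show "int d = gcd c ?g" 
    using 1 by (intro zdvd_antisym_nonneg of_nat_0_le_iff gcd_ge_0_int)
next
  let ?g = "gcd m n"
  assume dd: "int d = gcd c ?g"
  have "?g \<noteq> 0" using m by simp
  then obtain u where u: "coprime u m" "[u * c = int d] (mod ?g)"
    unfolding dd using unit_multiple_cong_gcd[OF m] by blast
  then obtain k where k: "u * c - int d = ?g * k" unfolding cong_iff_dvd_diff by (blast elim: dvdE)
  \<comment> \<open>Of the two Bezout terms, the multiple of m vanishes modulo m and the multiple of
    n is absorbed by the shift, whence t = q k.\<close>
  obtain p q where "p * m + q * n = ?g" using bezout_int by blast
  then have "u * c - int d = (p * m + q * n) * k" using k by simp
  then have "u * c + q * k - ((n + 1) * (q * k) + int d) = m * (p * k)" by (simp add: algebra_simps)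
  then have "[u * c + q * k = (n + 1) * (q * k) + int d] (mod m)" 
    unfolding cong_iff_dvd_diff by (rule dvdI)
  then show "\<exists>u t. coprime u m \<and> [u * c + t = (n + 1) * t + int d] (mod m)" using u(1) by blast
qed

section \<open>Affine operations on residues and their isomorphisms\<close>

text \<open>\<open>e\<close> factors through a bijection between the integers modulo \<open>m\<close> and \<open>S\<close>. Both the powers
  of a generator and the residue classes are of this kind.\<close>

definition residue_param :: "int \<Rightarrow> (int \<Rightarrow> 'a) \<Rightarrow> 'a set \<Rightarrow> bool" where
  "residue_param m e S \<longleftrightarrow> range e = S \<and> (\<forall>i j. e i = e j \<longleftrightarrow> [i = j] (mod m))"

lemma residue_param_eq_iff:
  "residue_param m e S \<Longrightarrow> e i = e j \<longleftrightarrow> [i = j] (mod m)"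
  by (simp add: residue_param_def)

lemma residue_param_mem: "residue_param m e S \<Longrightarrow> e i \<in> S"
  by (auto simp: residue_param_def)

lemma residue_param_surj: "residue_param m e S \<Longrightarrow> x \<in> S \<Longrightarrow> \<exists>i. x = e i"
  by (auto simp: residue_param_def)

lemma residue_param_ball:
  "residue_param m e S \<Longrightarrow> (\<forall>x\<in>S. P x) \<longleftrightarrow> (\<forall>i. P (e i))"
  by (auto simp: residue_param_def)

text \<open>Used three times: as the isomorphism between affine operations, to solve equations in
  one argument, and with t = 0 as multiplication by a unit.\<close>

lemma bij_betw_residue_param_affine:
  assumes e: "residue_param m e S" and e': "residue_param m e' S'" and u: "coprime u m"
  shows "\<exists>h. bij_betw h S S' \<and> (\<forall>i. h (e i) = e' (u * i + t))"
proof -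
  \<comment> \<open>An arbitrary representative of x is chosen; another choice is congruent to it
    modulo m, so the value of \<open>e'\<close> is the same.\<close>
  define h where "h x = e' (u * (SOME i. e i = x) + t)" for x
  have he: "h (e i) = e' (u * i + t)" for i
  proof -
    have "e (SOME j. e j = e i) = e i" by (rule someI[of "\<lambda>j. e j = e i" i]) simp
    then have "[(SOME j. e j = e i) = i] (mod m)" using residue_param_eq_iff[OF e] by blast
    then show ?thesis unfolding h_def residue_param_eq_iff[OF e']
      by (intro cong_add cong_mult) auto
  qed
  have "inj_on h S"
  proof (rule inj_onI)
    fix x y assume "x \<in> S" "y \<in> S" "h x = h y"
    then obtain i j where ij: "x = e i" "y = e j" using residue_param_surj[OF e] by blast
    then have "[u * i + t = u * j + t] (mod m)"
      using \<open>h x = h y\<close> by (simp add: he residue_param_eq_iff[OF e'])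
    then have "[i = j] (mod m)" using u by (simp add: cong_add_rcancel cong_mult_lcancel coprime_commute)
    then show "x = y" using ij residue_param_eq_iff[OF e] by blast
  qed
  moreover have "h ` S = S'"
  proof (intro equalityI subsetI)
    fix y assume "y \<in> h ` S"
    then show "y \<in> S'" using residue_param_surj[OF e] residue_param_mem[OF e'] by (auto simp: h_def)
  next
    fix y assume "y \<in> S'"
    then obtain j where j: "y = e' j" using residue_param_surj[OF e'] by blast
    obtain v where "[u * v = 1] (mod m)" using u cong_solve_coprime_int by blast
    then have "[(u * v) * (j - t) + t = 1 * (j - t) + t] (mod m)" 
      by (intro cong_add cong_mult) auto
    then have "h (e (v * (j - t))) = y" unfolding he j residue_param_eq_iff[OF e'] 
      by (simp add: mult.assoc)
    then show "y \<in> h ` S" using residue_param_mem[OF e] by blast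
  qed
  ultimately show ?thesis using he unfolding bij_betw_def by blast
qed

lemma cong_linear_if_constant_step:
  fixes H :: "int \<Rightarrow> int"
  assumes "\<And>k. [H (k + 1) = H k + u] (mod m)"
  shows "[H k = u * k + H 0] (mod m)"
proof (induction k rule: int_induct[where k = 0])
  case base then show ?case by simp
next
  case (step1 i)
  have "[H (i + 1) = H i + u] (mod m)" by (rule assms)
  also have "[H i + u = u * i + H 0 + u] (mod m)" using step1 by (intro cong_add) auto
  finally show ?case by (simp add: algebra_simps)
next
  case (step2 i)
  have "[H i = H (i - 1) + u] (mod m)" using assms[of "i - 1"] by simp
  then have "[H (i - 1) + u = u * i + H 0] (mod m)" using step2 by (metis cong_sym cong_trans)
  then have "[H (i - 1) + u - u = u * i + H 0 - u] (mod m)" by (intro cong_diff) auto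
  then show ?case by (simp add: algebra_simps)
qed

text \<open>Changing j from 0 to an inverse w of b raises the argument of H by one, whatever i is,
  and adds b' (H w - H 0) on the right. So H has constant increments.\<close>

lemma affine_hom_is_affine:
  fixes H :: "int \<Rightarrow> int"
  assumes H: "\<And>i j. [H (a * i + b * j + c) = a' * H i + b' * H j + c'] (mod m)"
    and cong: "\<And>i j. [i = j] (mod m) \<Longrightarrow> [H i = H j] (mod m)"
    and ab: "coprime a m" "coprime b m"
  shows "\<exists>u. \<forall>k. [H k = u * k + H 0] (mod m)"
proof -
  obtain v w where v: "[a * v = 1] (mod m)" and w: "[b * w = 1] (mod m)"
    using ab cong_solve_coprime_int by metis
  have "[H (k + 1) = H k + b' * (H w - H 0)] (mod m)" for k
  proof -
    \<comment> \<open>Since a v = 1, the operation takes the value k at (\<open>?i\<close>, 0) and k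
      + 1 at (\<open>?i\<close>, w).\<close>
    let ?i = "v * (k - c)"
    have k: "[a * ?i + c = k] (mod m)"
    proof -
      have "[a * v * (k - c) + c = 1 * (k - c) + c] (mod m)" using v by (intro cong_add cong_mult) auto
      then show ?thesis by (simp add: mult.assoc)
    qed
    have "[H k = H (a * ?i + b * 0 + c)] (mod m)" using k by (intro cong) (simp add: cong_sym)
    also have "[H (a * ?i + b * 0 + c) = a' * H ?i + b' * H 0 + c'] (mod m)" by (rule H)
    finally have 0: "[H k = a' * H ?i + b' * H 0 + c'] (mod m)" .
    have "[a * ?i + b * w + c = k + 1] (mod m)" using cong_add[OF k w] by (simp add: algebra_simps)
    then have "[H (k + 1) = H (a * ?i + b * w + c)] (mod m)" by (intro cong) (simp add: cong_sym)
    also have "[H (a * ?i + b * w + c) = a' * H ?i + b' * H w + c'] (mod m)" by (rule H)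
    also have "a' * H ?i + b' * H w + c' = a' * H ?i + b' * H 0 + c' + b' * (H w - H 0)"
      by (simp add: algebra_simps)
    also have "[a' * H ?i + b' * H 0 + c' + b' * (H w - H 0) = H k + b' * (H w - H 0)] (mod m)" using 0 by (intro cong_add) (auto simp: cong_sym)
    finally show ?thesis .
  qed
  then show ?thesis using cong_linear_if_constant_step by blast
qed

text \<open>The last condition compares the constant terms of both sides of the homomorphism
  equation under i -> u i + t; for the converse this same map is the isomorphism.\<close>

lemma isomorphic_affine_iff:
  assumes e: "residue_param m e S" and e': "residue_param m e' S'"
    and f: "\<And>i j. f (e i) (e j) = e (a * i + b * j + c)"
    and f': "\<And>i j. f' (e' i) (e' j) = e' (a' * i + b' * j + c')"
    and ab: "coprime a m" "coprime b m"
  shows "quasigroup_isomorphic S f S' f' \<longleftrightarrow>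
    [a = a'] (mod m) \<and> [b = b'] (mod m) \<and>
    (\<exists>u t. coprime u m \<and> [u * c + t = (a + b) * t + c'] (mod m))"
proof
  assume "quasigroup_isomorphic S f S' f'"
  then obtain h where h: "bij_betw h S S'" 
    and hom: "\<And>x y. x \<in> S \<Longrightarrow> y \<in> S \<Longrightarrow> h (f x y) = f' (h x) (h y)"
    unfolding quasigroup_isomorphic_def by blast
  have "\<exists>j. h (e i) = e' j" for i
    using h residue_param_mem[OF e] residue_param_surj[OF e'] by (auto simp: bij_betw_def)
  then obtain H where he: "\<And>i. h (e i) = e' (H i)" by metis
  have H: "[H (a * i + b * j + c) = a' * H i + b' * H j + c'] (mod m)" for i j
    using hom[OF residue_param_mem[OF e] residue_param_mem[OF e], of i j]
    by (simp add: f f' he residue_param_eq_iff[OF e'])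
  have Hcong: "[H i = H j] (mod m) \<longleftrightarrow> [i = j] (mod m)" for i j
  proof -
    have "[H i = H j] (mod m) \<longleftrightarrow> h (e i) = h (e j)" by (simp add: he residue_param_eq_iff[OF e'])
    also have "\<dots> \<longleftrightarrow> e i = e j" 
      using h residue_param_mem[OF e] inj_on_eq_iff[of h S "e i" "e j"] by (simp add: bij_betw_def)
    finally show ?thesis by (simp add: residue_param_eq_iff[OF e])
  qed
  obtain u where u: "\<And>k. [H k = u * k + H 0] (mod m)"
    using affine_hom_is_affine[OF H _ ab] Hcong by blast
  \<comment> \<open>Surjectivity of h is what makes the slope u invertible.\<close>
  have "\<exists>k. [H k = H 0 + 1] (mod m)"
  proof -
    have "e' (H 0 + 1) \<in> h ` S" using h residue_param_mem[OF e'] by (simp add: bij_betw_def)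
    then obtain k where "e' (H 0 + 1) = h (e k)" using residue_param_surj[OF e] by blast
    then show ?thesis by (metis he residue_param_eq_iff[OF e'])
  qed
  then obtain k where "[u * k + H 0 = H 0 + 1] (mod m)" using u by (metis cong_sym cong_trans)
  then have "[u * k = 1] (mod m)" by (simp add: cong_iff_dvd_diff algebra_simps)
  then have cop: "coprime u m" using coprime_iff_invertible_int by blast
  \<comment> \<open>Two affine functions of (i, j) agree modulo m. Subtracting the values at (0,0)
    from those at (1,0) and (0,1) isolates the coefficients, from which u cancels.\<close>
  have aff: "m dvd u * (a * i + b * j + c) + H 0 - (a' * (u * i + H 0) + b' * (u * j + H 0) + c')" for i j
  proof -
    have "[u * (a * i + b * j + c) + H 0 = H (a * i + b * j + c)] (mod m)"
      using u by (simp add: cong_sym)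
    also have "[H (a * i + b * j + c) = a' * H i + b' * H j + c'] (mod m)" by (rule H)
    also have "[a' * H i + b' * H j + c' = a' * (u * i + H 0) + b' * (u * j + H 0) + c'] (mod m)" 
      using u by (intro cong_add cong_mult) auto
    finally show ?thesis by (simp add: cong_iff_dvd_diff)
  qed
  have "m dvd u * a - u * a'" using dvd_diff[OF aff[of 1 0] aff[of 0 0]] by (simp add: algebra_simps)
  then have aa: "[a = a'] (mod m)" using cop
    by (simp add: cong_iff_dvd_diff flip: right_diff_distrib)
       (metis coprime_commute coprime_dvd_mult_right_iff)
  have "m dvd u * b - u * b'" using dvd_diff[OF aff[of 0 1] aff[of 0 0]] by (simp add: algebra_simps)
  then have bb: "[b = b'] (mod m)" using cop
    by (simp add: cong_iff_dvd_diff flip: right_diff_distrib)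
       (metis coprime_commute coprime_dvd_mult_right_iff)
  have "[u * c + H 0 = (a' + b') * H 0 + c'] (mod m)" 
    using aff[of 0 0] by (simp add: cong_iff_dvd_diff algebra_simps)
  also have "[(a' + b') * H 0 + c' = (a + b) * H 0 + c'] (mod m)" using aa bb
    by (intro cong_add cong_mult) (auto simp: cong_sym)
  finally show "[a = a'] (mod m) \<and> [b = b'] (mod m) \<and>
    (\<exists>u t. coprime u m \<and> [u * c + t = (a + b) * t + c'] (mod m))" using aa bb cop by blast
next
  assume "[a = a'] (mod m) \<and> [b = b'] (mod m) \<and>
    (\<exists>u t. coprime u m \<and> [u * c + t = (a + b) * t + c'] (mod m))"
  then obtain u t where aa: "[a = a'] (mod m)" and bb: "[b = b'] (mod m)" and u: "coprime u m"
    and ut: "[u * c + t = (a + b) * t + c'] (mod m)" by blast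
  obtain h where h: "bij_betw h S S'" and he: "\<And>i. h (e i) = e' (u * i + t)"
    using bij_betw_residue_param_affine[OF e e' u] by metis
  have "h (f (e i) (e j)) = f' (h (e i)) (h (e j))" for i j
  proof -
    have "[u * (a * i + b * j) + (u * c + t) = u * (a * i + b * j) + ((a + b) * t + c')] (mod m)"
      using ut by (rule cong_add[OF cong_refl])
    also have "u * (a * i + b * j) + ((a + b) * t + c') = a * (u * i + t) + b * (u * j + t) + c'"
      by (simp add: algebra_simps)
    also have "[a * (u * i + t) + b * (u * j + t) + c' = a' * (u * i + t) + b' * (u * j + t) + c'] (mod m)"
      using aa bb by (intro cong_add cong_mult) auto
    finally show ?thesis by (simp add: f f' he residue_param_eq_iff[OF e'] algebra_simps)
  qed
  then have "\<forall>x\<in>S. \<forall>y\<in>S. h (f x y) = f' (h x) (h y)"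
    using residue_param_surj[OF e] by blast
  then show "quasigroup_isomorphic S f S' f'" using h unfolding quasigroup_isomorphic_def by blast
qed

section \<open>Symmetry groups read off the graph of the operation\<close>

text \<open>A parastrophe only permutes the coordinates of the graph, so a symmetry is a permutation
  that maps the graph into itself. This removes the definite description from the later
  arguments.\<close>

lemma Sym_iff:
  assumes Q: "quasigroup Q f"
  shows "\<sigma> \<in> Sym Q f \<longleftrightarrow> \<sigma> \<in> carrier (sym_group 3) \<and>
    (\<forall>x\<in>{1..3::nat} \<rightarrow> Q. f (x 1) (x 2) = x 3 \<longrightarrow> f (x (\<sigma> 1)) (x (\<sigma> 2)) = x (\<sigma> 3))"
    (is "_ \<longleftrightarrow> _ \<and> ?P")
proof (cases "\<sigma> \<in> carrier (sym_group 3)")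
  case True
  then have perm: "\<sigma> permutes {1..3}" by (simp add: sym_group_def)
  have in3: "\<sigma> i \<in> {1..3}" if "i \<in> {1..3}" for i
    using permutes_in_image[OF perm] that by simp
  have neq: "\<sigma> 1 \<noteq> \<sigma> 3" "\<sigma> 2 \<noteq> \<sigma> 3" "\<sigma> 1 \<noteq> \<sigma> 2"
    by (simp_all add: inj_eq[OF permutes_inj[OF perm]])
  have "\<sigma> \<in> Sym Q f \<longleftrightarrow> (\<forall>a\<in>Q. \<forall>b\<in>Q. parastrophe Q f \<sigma> a b = f a b)"
    using True by (simp add: Sym_def)
  also have "\<dots> \<longleftrightarrow> ?P"
  proof
    assume *: "\<forall>a\<in>Q. \<forall>b\<in>Q. parastrophe Q f \<sigma> a b = f a b"
    show ?P
    proof (intro ballI impI)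
      fix x :: "nat \<Rightarrow> 'a" assume x: "x \<in> {1..3} \<rightarrow> Q" "f (x 1) (x 2) = x 3"
      have "x (\<sigma> 1) \<in> Q" "x (\<sigma> 2) \<in> Q" using x(1) in3 by (auto simp: Pi_iff)
      then show "f (x (\<sigma> 1)) (x (\<sigma> 2)) = x (\<sigma> 3)"
        using * parastrophe_iff[OF Q True x(1)] x(2) by simp
    qed
  next
    assume P: ?P
    show "\<forall>a\<in>Q. \<forall>b\<in>Q. parastrophe Q f \<sigma> a b = f a b"
    proof (intro ballI)
      fix a b assume ab: "a \<in> Q" "b \<in> Q"
      \<comment> \<open>The entry at \<open>\<sigma> 3\<close> is a placeholder: completing the
        triple to a point of the graph changes that coordinate only.\<close>
      have "(\<lambda>j. if j = \<sigma> 1 then a else b) \<in> {1..3} \<rightarrow> Q" using ab by simp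
      from quasigroup_graph_exists[OF Q this in3[of 3]]
      obtain x where x: "x \<in> {1..3} \<rightarrow> Q" "f (x 1) (x 2) = x 3"
        and xj: "\<And>j. j \<noteq> \<sigma> 3 \<Longrightarrow> x j = (if j = \<sigma> 1 then a else b)" by auto
      have "x (\<sigma> 1) = a" "x (\<sigma> 2) = b" using xj neq by auto
      then show "parastrophe Q f \<sigma> a b = f a b"
        using P x parastrophe_iff[OF Q True x(1)] by metis
    qed
  qed
  finally show ?thesis using True by simp
qed (simp add: Sym_def)

lemma graph_ball_iff:
  assumes "\<And>a b. a \<in> Q \<Longrightarrow> b \<in> Q \<Longrightarrow> f a b \<in> Q"
  shows "(\<forall>x\<in>{1..3::nat} \<rightarrow> Q. f (x 1) (x 2) = x 3 \<longrightarrow> P (x 1) (x 2) (x 3)) \<longleftrightarrow>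
    (\<forall>a\<in>Q. \<forall>b\<in>Q. P a b (f a b))"
proof (intro iffI ballI impI)
  fix a b assume *: "\<forall>x\<in>{1..3::nat} \<rightarrow> Q. f (x 1) (x 2) = x 3 \<longrightarrow> P (x 1) (x 2) (x 3)"
    and ab: "a \<in> Q" "b \<in> Q"
  have "(\<lambda>j. if j = 1 then a else if j = 2 then b else f a b) \<in> {1..3::nat} \<rightarrow> Q"
    using ab assms by simp
  from bspec[OF * this] show "P a b (f a b)" by simp
next
  fix x assume "\<forall>a\<in>Q. \<forall>b\<in>Q. P a b (f a b)" "x \<in> {1..3::nat} \<rightarrow> Q" "f (x 1) (x 2) = x 3"
  moreover from this have "x 1 \<in> Q" "x 2 \<in> Q" by (auto simp: Pi_iff)
  ultimately show "P (x 1) (x 2) (x 3)" by metis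
qed

text \<open>\<open>perm_sr\<close> maps 1 to 2, 2 to 3 and 3 to 1, and \<open>perm_rs\<close> is its inverse.\<close>

abbreviation perm_sr :: "nat \<Rightarrow> nat" where "perm_sr \<equiv> perm_s \<circ> perm_r"
abbreviation perm_rs :: "nat \<Rightarrow> nat" where "perm_rs \<equiv> perm_r \<circ> perm_s"

lemma permutes_3_eqI:
  assumes "p permutes {1..3::nat}" "q permutes {1..3}" "p 1 = q 1" "p 2 = q 2" "p 3 = q 3"
  shows "p = q"
proof
  fix i
  show "p i = q i"
  proof (cases "i \<in> {1..3}")
    case True
    then have "i = 1 \<or> i = 2 \<or> i = 3" by auto
    then show ?thesis using assms(3-5) by auto
  next
    case False
    then show ?thesis using assms(1,2) by (simp add: permutes_not_in)
  qed
qed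

lemma carrier_sym_group_3:
  "carrier (sym_group 3) = {id, perm_s, perm_l, perm_r, perm_sr, perm_rs}"
proof
  have perms: "perm_s permutes {1..3}" "perm_l permutes {1..3}" "perm_r permutes {1..3}"
    "id permutes {1..3::nat}"
    by (auto intro!: permutes_swap_id permutes_id)
  then have perms2: "perm_sr permutes {1..3}" "perm_rs permutes {1..3}"
    by (auto intro!: permutes_compose)
  show "{id, perm_s, perm_l, perm_r, perm_sr, perm_rs} \<subseteq> carrier (sym_group 3)"
    using perms perms2 by (simp add: sym_group_carrier)
  show "carrier (sym_group 3) \<subseteq> {id, perm_s, perm_l, perm_r, perm_sr, perm_rs}"
  proof
    fix p assume "p \<in> carrier (sym_group 3)"
    then have p: "p permutes {1..3}" by (simp add: sym_group_carrier)
    have "p i \<in> {1..3}" if "i \<in> {1..3}" for i using permutes_in_image[OF p] that by simp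
    from this[of 1] this[of 2] this[of 3]
    have "p 1 = 1 \<or> p 1 = 2 \<or> p 1 = 3" "p 2 = 1 \<or> p 2 = 2 \<or> p 2 = 3" "p 3 = 1 \<or> p 3 = 2 \<or> p 3 = 3"
      by auto
    moreover have "p 1 \<noteq> p 3" "p 2 \<noteq> p 3" "p 1 \<noteq> p 2"
      by (simp_all add: inj_eq[OF permutes_inj[OF p]])
    ultimately consider "p 1 = 1" "p 2 = 2" "p 3 = 3" | "p 1 = 2" "p 2 = 1" "p 3 = 3"
      | "p 1 = 3" "p 2 = 2" "p 3 = 1" | "p 1 = 1" "p 2 = 3" "p 3 = 2"
      | "p 1 = 2" "p 2 = 3" "p 3 = 1" | "p 1 = 3" "p 2 = 1" "p 3 = 2"
      by metis
    then show "p \<in> {id, perm_s, perm_l, perm_r, perm_sr, perm_rs}"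
    proof cases
      case 1 then have "p = id" by (intro permutes_3_eqI[OF p perms(4)]) simp_all
      then show ?thesis by simp
    next
      case 2 then have "p = perm_s" by (intro permutes_3_eqI[OF p perms(1)]) simp_all
      then show ?thesis by simp
    next
      case 3 then have "p = perm_l" by (intro permutes_3_eqI[OF p perms(2)]) simp_all
      then show ?thesis by simp
    next
      case 4 then have "p = perm_r" by (intro permutes_3_eqI[OF p perms(3)]) simp_all
      then show ?thesis by simp
    next
      case 5 then have "p = perm_sr" by (intro permutes_3_eqI[OF p perms2(1)]) simp_all
      then show ?thesis by simp
    next
      case 6 then have "p = perm_rs" by (intro permutes_3_eqI[OF p perms2(2)]) simp_all
      then show ?thesis by simp
    qed
  qed
qed

lemma carrier_alt_group_3: "carrier (alt_group 3) = {id, perm_sr, perm_rs}"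
proof -
  have "carrier (alt_group 3) = {\<sigma> \<in> carrier (sym_group 3). evenperm \<sigma>}"
    by (auto simp: alt_group_carrier sym_group_carrier)
  moreover have "evenperm perm_sr" "evenperm perm_rs" "evenperm (id :: nat \<Rightarrow> nat)"
    "\<not> evenperm perm_s" "\<not> evenperm perm_l" "\<not> evenperm perm_r"
    by (simp_all add: evenperm_comp evenperm_swap permutation_swap_id)
  ultimately show ?thesis unfolding carrier_sym_group_3 by blast
qed

lemma perms_3_distinct: "distinct [id, perm_s, perm_l, perm_r, perm_sr, perm_rs]"
proof -
  \<comment> \<open>The permutations are told apart by their values at 1, 2 and 3, which the
    simplifier can evaluate.\<close>
  have "distinct (map (\<lambda>\<sigma>. (\<sigma> 1, \<sigma> 2, \<sigma> (3::nat))) [id, perm_s, perm_l, perm_r, perm_sr, perm_rs])"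
    by simp
  then show ?thesis by (simp only: distinct_map)
qed

text \<open>The two three-cycles give the two forms of semi-symmetry, with the inner product on the
  right or on the left. Both are listed because symmetry groups are later compared one permutation
  at a time.\<close>

lemma perms_3_in_Sym:
  assumes Q: "quasigroup Q f"
  shows "id \<in> Sym Q f"
    and "perm_s \<in> Sym Q f \<longleftrightarrow> (\<forall>x\<in>Q. \<forall>y\<in>Q. f y x = f x y)"
    and "perm_l \<in> Sym Q f \<longleftrightarrow> (\<forall>x\<in>Q. \<forall>y\<in>Q. f (f x y) y = x)"
    and "perm_r \<in> Sym Q f \<longleftrightarrow> (\<forall>x\<in>Q. \<forall>y\<in>Q. f x (f x y) = y)"
    and "perm_sr \<in> Sym Q f \<longleftrightarrow> (\<forall>x\<in>Q. \<forall>y\<in>Q. f y (f x y) = x)"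
    and "perm_rs \<in> Sym Q f \<longleftrightarrow> (\<forall>x\<in>Q. \<forall>y\<in>Q. f (f x y) x = y)"
proof -
  have cl: "\<And>a b. a \<in> Q \<Longrightarrow> b \<in> Q \<Longrightarrow> f a b \<in> Q" using Q by (simp add: quasigroup_def)
  note iff = Sym_iff[OF Q] carrier_sym_group_3
  show "id \<in> Sym Q f" by (simp add: iff)
  show "perm_s \<in> Sym Q f \<longleftrightarrow> (\<forall>x\<in>Q. \<forall>y\<in>Q. f y x = f x y)"
    using graph_ball_iff[of Q f "\<lambda>a b c. f b a = c", OF cl] by (simp add: iff)
  show "perm_l \<in> Sym Q f \<longleftrightarrow> (\<forall>x\<in>Q. \<forall>y\<in>Q. f (f x y) y = x)"
    using graph_ball_iff[of Q f "\<lambda>a b c. f c b = a", OF cl] by (simp add: iff)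
  show "perm_r \<in> Sym Q f \<longleftrightarrow> (\<forall>x\<in>Q. \<forall>y\<in>Q. f x (f x y) = y)"
    using graph_ball_iff[of Q f "\<lambda>a b c. f a c = b", OF cl] by (simp add: iff)
  show "perm_sr \<in> Sym Q f \<longleftrightarrow> (\<forall>x\<in>Q. \<forall>y\<in>Q. f y (f x y) = x)"
    using graph_ball_iff[of Q f "\<lambda>a b c. f b c = a", OF cl] by (simp add: iff)
  show "perm_rs \<in> Sym Q f \<longleftrightarrow> (\<forall>x\<in>Q. \<forall>y\<in>Q. f (f x y) x = y)"
    using graph_ball_iff[of Q f "\<lambda>a b c. f c a = b", OF cl] by (simp add: iff)
qed

text \<open>Six membership tests suffice, which makes each claim about a symmetry group a
  propositional one.\<close>

lemma Sym_eq_iff: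
  assumes "T \<subseteq> carrier (sym_group 3)"
  shows "Sym Q f = T \<longleftrightarrow>
    (\<forall>\<sigma> \<in> {id, perm_s, perm_l, perm_r, perm_sr, perm_rs}. \<sigma> \<in> Sym Q f \<longleftrightarrow> \<sigma> \<in> T)"
  using assms unfolding carrier_sym_group_3[symmetric] Sym_def by blast

text \<open>With one argument fixed, the other enters through i -> u i + t with u a unit, which is a
  bijection.\<close>

lemma quasigroup_affine:
  assumes e: "residue_param m e S"
    and f: "\<And>i j. f (e i) (e j) = e (a * i + b * j + c)"
    and ab: "coprime a m" "coprime b m"
  shows "quasigroup S f"
proof -
  have solve: "\<exists>!x. x \<in> S \<and> g x = y"
    if g: "\<And>i. g (e i) = e (u * i + t)" and u: "coprime u m" and y: "y \<in> S" for g u t y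
  proof -
    obtain h where h: "bij_betw h S S" "\<And>i. h (e i) = e (u * i + t)"
      using bij_betw_residue_param_affine[OF e e u] by metis
    have gh: "h x = g x" if x: "x \<in> S" for x
    proof -
      obtain i where "x = e i" using residue_param_surj[OF e x] by blast
      then show ?thesis by (simp only: g h(2))
    qed
    then have "bij_betw g S S" using h(1) bij_betw_cong[of S h g] by blast
    then have "inj_on g S" "y \<in> g ` S" using y by (simp_all add: bij_betw_def)
    then show ?thesis by (blast dest: inj_onD)
  qed
  show ?thesis unfolding quasigroup_def
  proof (intro conjI ballI)
    fix x y assume "x \<in> S" "y \<in> S"
    then obtain i j where "x = e i" "y = e j" using residue_param_surj[OF e] by blast
    then show "f x y \<in> S" by (simp only: f residue_param_mem[OF e])
  next
    fix y z assume y: "y \<in> S" and z: "z \<in> S"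
    obtain j where "y = e j" using residue_param_surj[OF e y] by blast
    then show "\<exists>!x. x \<in> S \<and> f x y = z"
      by (intro solve[OF _ ab(1) z, of "\<lambda>x. f x y" "b * j + c"]) (simp add: f add.assoc)
  next
    fix x z assume x: "x \<in> S" and z: "z \<in> S"
    obtain i where "x = e i" using residue_param_surj[OF e x] by blast
    then show "\<exists>!y. y \<in> S \<and> f x y = z"
      by (intro solve[OF _ ab(2) z, of "\<lambda>y. f x y" "a * i + c"]) (simp add: f ac_simps)
  qed
qed

section \<open>Computing in the residue ring with integer representatives\<close>

lemma residue_class_ring_hom: "residue_class m \<in> ring_hom \<Z> (Zmod m)"
proof -
  have "residue_class m = (+>\<^bsub>\<Z>\<^esub>) (Idl\<^bsub>\<Z>\<^esub> {int m})" by (simp add: residue_class_def fun_eq_iff)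
  then show ?thesis
    using ideal.rcos_ring_hom[OF int.genideal_ideal[of "{int m}"]] by (simp add: ZFact_def)
qed

lemma residue_param_residue_class: "residue_param (int m) (residue_class m) (carrier (Zmod m))"
  unfolding residue_param_def
proof (intro conjI allI)
  show "range (residue_class m) = carrier (Zmod m)"
    by (auto simp: ZFact_defs A_RCOSETS_def' residue_class_def)
  show "residue_class m i = residue_class m j \<longleftrightarrow> [i = j] (mod int m)" for i j
    using ZMod_eq_mod[of "int m" i j] by (simp add: residue_class_def ZMod_def cong_def)
qed

lemmas residue_class_eq_iff = residue_param_eq_iff[OF residue_param_residue_class]

lemma residue_class_simps:
  "residue_class m i \<oplus>\<^bsub>Zmod m\<^esub> residue_class m j = residue_class m (i + j)"
  "residue_class m i \<otimes>\<^bsub>Zmod m\<^esub> residue_class m j = residue_class m (i * j)"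
  "\<one>\<^bsub>Zmod m\<^esub> = residue_class m 1"
  "\<zero>\<^bsub>Zmod m\<^esub> = residue_class m 0"
  "\<ominus>\<^bsub>Zmod m\<^esub> residue_class m i = residue_class m (- i)"
  "residue_class m i \<ominus>\<^bsub>Zmod m\<^esub> residue_class m j = residue_class m (i - j)"
  "residue_class m i [^]\<^bsub>Zmod m\<^esub> n = residue_class m (i ^ n)" for n :: nat
proof -
  interpret Z: cring "Zmod m" by (rule ZFact_is_cring)
  note hom = residue_class_ring_hom[of m]
  show add: "residue_class m i \<oplus>\<^bsub>Zmod m\<^esub> residue_class m j = residue_class m (i + j)" for i j
    using ring_hom_add[OF hom, of i j] by simp
  show mult: "residue_class m i \<otimes>\<^bsub>Zmod m\<^esub> residue_class m j = residue_class m (i * j)" for i j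
    using ring_hom_mult[OF hom, of i j] by simp
  show one: "\<one>\<^bsub>Zmod m\<^esub> = residue_class m 1" using ring_hom_one[OF hom] by simp
  show zero: "\<zero>\<^bsub>Zmod m\<^esub> = residue_class m 0"
    using ring_hom_zero[OF hom int.ring_axioms Z.ring_axioms] by simp
  have mem: "residue_class m i \<in> carrier (Zmod m)" for i
    by (rule residue_param_mem[OF residue_param_residue_class])
  show neg: "\<ominus>\<^bsub>Zmod m\<^esub> residue_class m i = residue_class m (- i)" for i
    by (rule Z.minus_equality) (simp_all add: mem add zero)
  show "residue_class m i \<ominus>\<^bsub>Zmod m\<^esub> residue_class m j = residue_class m (i - j)"
    by (simp add: a_minus_def neg add)
  show "residue_class m i [^]\<^bsub>Zmod m\<^esub> n = residue_class m (i ^ n)"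
    by (induction n) (simp_all add: one mult mult.commute)
qed

lemma mem_residue_class_iff: "k \<in> residue_class m i \<longleftrightarrow> [k = i] (mod int m)"
proof
  assume "k \<in> residue_class m i"
  then obtain x where "k = x * int m + i"
    using rcos_zfact[of k "int m" i] by (auto simp: ZMod_def residue_class_def)
  then show "[k = i] (mod int m)" by (simp add: cong_def)
next
  assume "[k = i] (mod int m)"
  then have "k \<in> residue_class m k \<longleftrightarrow> k \<in> residue_class m i"
    by (simp add: residue_class_eq_iff[THEN iffD2])
  moreover have "k \<in> residue_class m k"
    by (auto simp: residue_class_def a_r_coset_defs int_Idl intro: exI[of _ 0])
  ultimately show "k \<in> residue_class m i" by simp
qed

lemma residue_class_Units_iff: "residue_class m a \<in> Units (Zmod m) \<longleftrightarrow> coprime a (int m)"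
proof -
  note p = residue_param_residue_class[of m]
  have "residue_class m a \<in> Units (Zmod m) \<longleftrightarrow> (\<exists>v. [a * v = 1] (mod int m))"
  proof
    assume "residue_class m a \<in> Units (Zmod m)"
    then obtain y where "y \<in> carrier (Zmod m)" "residue_class m a \<otimes>\<^bsub>Zmod m\<^esub> y = \<one>\<^bsub>Zmod m\<^esub>"
      unfolding Units_def by blast
    then show "\<exists>v. [a * v = 1] (mod int m)"
      using residue_param_surj[OF p] by (metis residue_class_simps(2,3) residue_class_eq_iff)
  next
    assume "\<exists>v. [a * v = 1] (mod int m)"
    then obtain v where "[a * v = 1] (mod int m)" by blast
    then have "residue_class m (a * v) = residue_class m 1"
      by (simp add: residue_class_eq_iff)
    then have "residue_class m a \<otimes>\<^bsub>Zmod m\<^esub> residue_class m v = \<one>\<^bsub>Zmod m\<^esub>"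
      "residue_class m v \<otimes>\<^bsub>Zmod m\<^esub> residue_class m a = \<one>\<^bsub>Zmod m\<^esub>"
      by (simp_all only: residue_class_simps mult.commute)
    then show "residue_class m a \<in> Units (Zmod m)" unfolding Units_def
      using residue_param_mem[OF p] by blast
  qed
  then show ?thesis by (simp add: coprime_iff_invertible_int)
qed

lemma residue_class_inv_iff:
  assumes "coprime a (int m)"
  shows "residue_class m b = inv\<^bsub>Zmod m\<^esub> residue_class m a \<longleftrightarrow> [a * b = 1] (mod int m)"
proof -
  interpret Z: cring "Zmod m" by (rule ZFact_is_cring)
  have mem: "residue_class m i \<in> carrier (Zmod m)" for i
    by (rule residue_param_mem[OF residue_param_residue_class])
  have U: "residue_class m a \<in> Units (Zmod m)" using assms by (simp add: residue_class_Units_iff)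
  have "residue_class m b = inv\<^bsub>Zmod m\<^esub> residue_class m a \<longleftrightarrow>
    residue_class m a \<otimes>\<^bsub>Zmod m\<^esub> residue_class m b = \<one>\<^bsub>Zmod m\<^esub>"
    using U mem Z.Units_r_inv Z.Units_inv_closed Z.Units_l_cancel by metis
  then show ?thesis by (simp add: residue_class_simps residue_class_eq_iff)
qed

text \<open>Congruence modulo m implies congruence modulo its divisor d, so divisibility by d can be
  tested on a single representative.\<close>

lemma canonical_triples_iff:
  "(residue_class m a, residue_class m b, d) \<in> canonical_triples m \<longleftrightarrow>
    coprime a (int m) \<and> coprime b (int m) \<and> 0 < d \<and> d dvd m \<and> int d dvd a + b - 1"
proof -
  have "(\<forall>k. [k = a + b - 1] (mod int m) \<longrightarrow> int d dvd k) \<longleftrightarrow> int d dvd a + b - 1" if "d dvd m"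
  proof (intro iffI allI impI)
    fix k assume "int d dvd a + b - 1" "[k = a + b - 1] (mod int m)"
    moreover from this have "[k = a + b - 1] (mod int d)"
      using that by (meson cong_dvd_modulus int_dvd_int_iff)
    ultimately show "int d dvd k" by (simp add: cong_dvd_iff)
  qed simp
  then show ?thesis
    unfolding canonical_triples_def
    by (auto simp: residue_class_Units_iff residue_class_simps mem_residue_class_iff Ball_def)
qed

lemma canonical_triplesE:
  assumes "(\<alpha>, \<beta>, d) \<in> canonical_triples m"
  obtains a b where "\<alpha> = residue_class m a" "\<beta> = residue_class m b"
    "coprime a (int m)" "coprime b (int m)" "0 < d" "d dvd m" "int d dvd a + b - 1"
proof -
  have "\<alpha> \<in> carrier (Zmod m)" "\<beta> \<in> carrier (Zmod m)"
    using assms by (auto simp: canonical_triples_def Units_def)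
  then obtain a b where "\<alpha> = residue_class m a" "\<beta> = residue_class m b"
    using residue_param_surj[OF residue_param_residue_class] by blast
  then show thesis using that assms canonical_triples_iff by blast
qed

lemma cyclic_isotope_op_residue_class:
  "cyclic_isotope_op m (residue_class m a) (residue_class m b) d (residue_class m i) (residue_class m j) =
    residue_class m (a * i + b * j + int d)"
  by (simp add: cyclic_isotope_op_def residue_class_simps)

section \<open>Classification by canonical triples\<close>

lemma isomorphic_cyclic_isotope_iff:
  assumes e: "residue_param (int m) e S" and m: "0 < m"
    and f: "\<And>i j. f (e i) (e j) = e (a * i + b * j + c)"
    and ab: "coprime a (int m)" "coprime b (int m)"
    and T: "(\<alpha>, \<beta>, d) \<in> canonical_triples m"
  shows "quasigroup_isomorphic S f (carrier (Zmod m)) (cyclic_isotope_op m \<alpha> \<beta> d) \<longleftrightarrow>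
    \<alpha> = residue_class m a \<and> \<beta> = residue_class m b \<and> int d = gcd c (gcd (int m) (a + b - 1))"
proof -
  obtain a' b' where ab': "\<alpha> = residue_class m a'" "\<beta> = residue_class m b'"
    and d: "0 < d" "d dvd m" "int d dvd a' + b' - 1"
    using canonical_triplesE[OF T] by metis
  let ?A = "[a = a'] (mod int m) \<and> [b = b'] (mod int m)"
  have "quasigroup_isomorphic S f (carrier (Zmod m)) (cyclic_isotope_op m \<alpha> \<beta> d) \<longleftrightarrow>
    ?A \<and> (\<exists>u t. coprime u (int m) \<and> [u * c + t = (a + b) * t + int d] (mod int m))"
    using isomorphic_affine_iff[where c' = "int d", OF e residue_param_residue_class f
      cyclic_isotope_op_residue_class ab] ab' by simp
  also have "\<dots> \<longleftrightarrow> ?A \<and> int d = gcd c (gcd (int m) (a + b - 1))"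
  \<comment> \<open>The congruences \<open>?A\<close> are available here; they carry the
    divisibility of a' + b' - 1 by d over to a + b - 1, as the solvability criterion
    requires.\<close>
  proof (rule conj_cong[OF refl])
    assume A: ?A
    then have "[a + b - 1 = a' + b' - 1] (mod int m)" by (intro cong_add cong_diff) auto
    then have "[a + b - 1 = a' + b' - 1] (mod int d)"
      using d(2) by (meson cong_dvd_modulus int_dvd_int_iff)
    then have "int d dvd a + b - 1" using d(3) by (simp add: cong_dvd_iff)
    from affine_shift_solvable_iff[OF _ d(1) _ this, of "int m" c] m d(2)
    show "(\<exists>u t. coprime u (int m) \<and> [u * c + t = (a + b) * t + int d] (mod int m)) \<longleftrightarrow>
      int d = gcd c (gcd (int m) (a + b - 1))" by simp
  qed
  finally show ?thesis using ab' by (auto simp: residue_class_eq_iff cong_sym_eq)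
qed

text \<open>The equivalence leaves one candidate, and it remains to see that it is canonical. If m
  divides both c and a + b - 1, its last entry is m, which stands for the constant 0.\<close>

lemma ex1_isomorphic_cyclic_isotope:
  assumes e: "residue_param (int m) e S" and m: "0 < m"
    and f: "\<And>i j. f (e i) (e j) = e (a * i + b * j + c)"
    and ab: "coprime a (int m)" "coprime b (int m)"
  shows "\<exists>!(\<alpha>, \<beta>, d) \<in> canonical_triples m.
    quasigroup_isomorphic S f (carrier (Zmod m)) (cyclic_isotope_op m \<alpha> \<beta> d)"
proof -
  define d where "d = nat (gcd c (gcd (int m) (a + b - 1)))"
  have d: "int d = gcd c (gcd (int m) (a + b - 1))" by (simp add: d_def)
  have "gcd c (gcd (int m) (a + b - 1)) \<noteq> 0" using m by simp
  then have "0 < d" using d by linarith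
  moreover have "int d dvd int m" "int d dvd a + b - 1" unfolding d by (meson dvd_trans gcd_dvd1 gcd_dvd2)+
  ultimately have T: "(residue_class m a, residue_class m b, d) \<in> canonical_triples m"
    using ab by (simp add: canonical_triples_iff)
  note iso = isomorphic_cyclic_isotope_iff[OF e m f ab]
  show ?thesis
    by (rule ex1I[of _ "(residue_class m a, residue_class m b, d)"])
       (use T iso d in auto)
qed

section \<open>Linear isotopes of cyclic groups in terms of exponents\<close>

lemma cyclic_group_residue_param:
  fixes G (structure)
  assumes "group G" "cyclic_group G" "order G = m" "0 < m"
  obtains g where "g \<in> carrier G"
    "residue_param (int m) (\<lambda>i::int. g [^]\<^bsub>G\<^esub> i) (carrier G)"
proof -
  interpret group G by fact
  obtain g where g: "g \<in> carrier G" "carrier G = range (\<lambda>n::int. g [^] n)"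
    using assms(2) cyclic_group by blast
  have "generate G {g} = carrier G" using g generate_pow[OF g(1)] by auto
  then have "ord g = m" using generate_pow_card[OF g(1)] assms(3) by (simp add: order_def)
  then have "residue_param (int m) (\<lambda>i::int. g [^] i) (carrier G)"
    unfolding residue_param_def
    using g int_pow_eq[OF g(1)] by (simp add: cong_iff_dvd_diff dvd_diff_commute)
  then show thesis using that g(1) by blast
qed

text \<open>The image of the generator is some power with exponent a; since the automorphism also
  reaches the generator, a is invertible modulo m.\<close>

lemma iso_cyclic_group:
  fixes G (structure)
  assumes "group G" "g \<in> carrier G"
    and e: "residue_param m (\<lambda>i::int. g [^]\<^bsub>G\<^esub> i) (carrier G)"
    and \<phi>: "\<phi> \<in> iso G G"
  obtains a where "coprime a m" "\<And>i::int. \<phi> (g [^]\<^bsub>G\<^esub> i) = g [^]\<^bsub>G\<^esub> (a * i)"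
proof -
  interpret group G by fact
  interpret \<phi>: group_hom G G \<phi>
    by unfold_locales (use \<phi> in \<open>simp add: iso_def\<close>)
  obtain a where a: "\<phi> g = g [^] (a::int)"
    using residue_param_surj[OF e] \<phi>.hom_closed[OF assms(2)] by blast
  have pow: "\<phi> (g [^] i) = g [^] (a * i)" for i :: int
    using assms(2) by (simp add: \<phi>.hom_int_pow a int_pow_pow)
  have "g [^] (1::int) \<in> \<phi> ` carrier G"
    using \<phi> residue_param_mem[OF e, of 1] by (simp add: iso_def bij_betw_def)
  then obtain i :: int where "g [^] (1::int) = \<phi> (g [^] i)"
    using residue_param_surj[OF e] by (metis imageE)
  then have "[1 = a * i] (mod m)" using residue_param_eq_iff[OF e] pow by metis
  then have "coprime a m" using coprime_iff_invertible_int cong_sym by blast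
  then show thesis using that pow by blast
qed

lemma linear_isotope_cyclic_group_affine:
  fixes G (structure)
  assumes G: "group G" "g \<in> carrier G"
    and e: "residue_param m (\<lambda>i::int. g [^]\<^bsub>G\<^esub> i) (carrier G)"
    and f: "linear_isotope G f"
  obtains a b c where "coprime a m" "coprime b m"
    "\<And>i j. f (g [^]\<^bsub>G\<^esub> i) (g [^]\<^bsub>G\<^esub> j) = g [^]\<^bsub>G\<^esub> (a * i + b * j + c)"
proof -
  interpret group G by fact
  obtain \<phi> \<psi> z where \<phi>: "\<phi> \<in> iso G G" and \<psi>: "\<psi> \<in> iso G G" and z: "z \<in> carrier G"
    and fz: "\<And>x y. x \<in> carrier G \<Longrightarrow> y \<in> carrier G \<Longrightarrow> f x y = \<phi> x \<otimes> z \<otimes> \<psi> y"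
    using f unfolding linear_isotope_def by blast
  obtain a where a: "coprime a m" "\<And>i::int. \<phi> (g [^] i) = g [^] (a * i)"
    using iso_cyclic_group[OF G e \<phi>] by blast
  obtain b where b: "coprime b m" "\<And>i::int. \<psi> (g [^] i) = g [^] (b * i)"
    using iso_cyclic_group[OF G e \<psi>] by blast
  obtain c :: int where c: "z = g [^] c" using residue_param_surj[OF e z] by blast
  have "f (g [^] i) (g [^] j) = g [^] (a * i + b * j + c)" for i j :: int
  proof -
    have "f (g [^] i) (g [^] j) = g [^] (a * i + c + b * j)"
      using G(2) by (simp add: fz a b c int_pow_mult)
    then show ?thesis by (simp add: ac_simps)
  qed
  then show thesis using that a(1) b(1) by blast
qed

text \<open>Multiplication by a unit is an automorphism of the additive group, so the canonical
  operations themselves are linear isotopes.\<close>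

lemma linear_isotope_add_monoid:
  assumes ab: "coprime a (int m)" "coprime b (int m)"
  shows "linear_isotope (add_monoid (Zmod m))
    (cyclic_isotope_op m (residue_class m a) (residue_class m b) d)"
proof -
  note e = residue_param_residue_class[of m]
  interpret Z: cring "Zmod m" by (rule ZFact_is_cring)
  have iso: "(\<lambda>x. residue_class m u \<otimes>\<^bsub>Zmod m\<^esub> x) \<in> iso (add_monoid (Zmod m)) (add_monoid (Zmod m))"
    if u: "coprime u (int m)" for u
  proof -
    obtain h where h: "bij_betw h (carrier (Zmod m)) (carrier (Zmod m))"
      "\<And>i. h (residue_class m i) = residue_class m (u * i + 0)"
      using bij_betw_residue_param_affine[OF e e u] by metis
    have "h x = residue_class m u \<otimes>\<^bsub>Zmod m\<^esub> x" if x: "x \<in> carrier (Zmod m)" for x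
    proof -
      obtain i where "x = residue_class m i" using residue_param_surj[OF e x] by blast
      then show ?thesis by (simp add: h(2) residue_class_simps)
    qed
    then have "bij_betw (\<lambda>x. residue_class m u \<otimes>\<^bsub>Zmod m\<^esub> x) (carrier (Zmod m)) (carrier (Zmod m))"
      using h(1) bij_betw_cong by blast
    moreover have "residue_class m u \<in> carrier (Zmod m)" by (rule residue_param_mem[OF e])
    ultimately show ?thesis by (auto simp: iso_def hom_def Z.r_distr)
  qed
  have "cyclic_isotope_op m (residue_class m a) (residue_class m b) d x y =
    residue_class m a \<otimes>\<^bsub>Zmod m\<^esub> x \<oplus>\<^bsub>Zmod m\<^esub> residue_class m (int d) \<oplus>\<^bsub>Zmod m\<^esub>
    residue_class m b \<otimes>\<^bsub>Zmod m\<^esub> y" if xy: "x \<in> carrier (Zmod m)" "y \<in> carrier (Zmod m)" for x y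
    using residue_param_mem[OF e] xy by (simp add: cyclic_isotope_op_def Z.a_ac)
  moreover have "quasigroup (carrier (Zmod m))
    (cyclic_isotope_op m (residue_class m a) (residue_class m b) d)"
    by (rule quasigroup_affine[OF e cyclic_isotope_op_residue_class ab])
  ultimately show ?thesis
    unfolding linear_isotope_def using iso[OF ab(1)] iso[OF ab(2)] residue_param_mem[OF e, of "int d"]
    by (intro conjI bexI[of _ "\<lambda>x. residue_class m a \<otimes>\<^bsub>Zmod m\<^esub> x"]
          bexI[of _ "\<lambda>x. residue_class m b \<otimes>\<^bsub>Zmod m\<^esub> x"]
          bexI[of _ "residue_class m (int d)"]) simp_all
qed

section \<open>Parastrophic identities of affine operations\<close>

lemma affine_commutative_iff:
  fixes a b d m :: int
  shows "(\<forall>i j. [a * j + b * i + d = a * i + b * j + d] (mod m)) \<longleftrightarrow> m dvd a - b"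
proof
  assume "\<forall>i j. [a * j + b * i + d = a * i + b * j + d] (mod m)"
  then have "[a * 1 + b * 0 + d = a * 0 + b * 1 + d] (mod m)" by blast
  then show "m dvd a - b" by (simp add: cong_iff_dvd_diff)
next
  assume "m dvd a - b"
  then have "m dvd (a - b) * (j - i)" for i j by simp
  moreover have "(a - b) * (j - i) = a * j + b * i + d - (a * i + b * j + d)" for i j
    by (simp add: algebra_simps)
  ultimately show "\<forall>i j. [a * j + b * i + d = a * i + b * j + d] (mod m)"
    unfolding cong_iff_dvd_diff by metis
qed

text \<open>Raising j from 0 to 1 changes the left side by b (a + 1), and b is a unit. Conversely,
  the difference of the two sides has the factor a + 1.\<close>

lemma affine_right_symmetric_iff:
  fixes a b d m :: int
  assumes "coprime b m"
  shows "(\<forall>i j. [a * (a * i + b * j + d) + b * j + d = i] (mod m)) \<longleftrightarrow> m dvd a + 1"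
proof
  assume *: "\<forall>i j. [a * (a * i + b * j + d) + b * j + d = i] (mod m)"
  have "m dvd (a * (b * 1 + d) + b * 1 + d) - (a * (b * 0 + d) + b * 0 + d)"
    using *[rule_format, of 0 1] *[rule_format, of 0 0]
    by (intro dvd_diff) (simp_all add: cong_iff_dvd_diff)
  then have "m dvd b * (a + 1)" by (simp add: algebra_simps)
  then show "m dvd a + 1" using assms by (simp add: coprime_commute coprime_dvd_mult_right_iff)
next
  assume "m dvd a + 1"
  then have "m dvd (a + 1) * ((a - 1) * i + b * j + d)" for i j by simp
  moreover have "(a + 1) * ((a - 1) * i + b * j + d) = a * (a * i + b * j + d) + b * j + d - i" for i j
    by (simp add: algebra_simps)
  ultimately show "\<forall>i j. [a * (a * i + b * j + d) + b * j + d = i] (mod m)"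
    by (simp add: cong_iff_dvd_diff)
qed

text \<open>Interchanging the arguments swaps a with b and turns this into the right symmetric
  case.\<close>

lemma affine_left_symmetric_iff:
  fixes a b d m :: int
  assumes "coprime a m"
  shows "(\<forall>i j. [a * i + b * (a * i + b * j + d) + d = j] (mod m)) \<longleftrightarrow> m dvd b + 1"
proof -
  have "a * i + b * (a * i + b * j + d) + d = b * (b * j + a * i + d) + a * i + d" for i j
    by (simp add: ac_simps)
  then have "(\<forall>i j. [a * i + b * (a * i + b * j + d) + d = j] (mod m)) \<longleftrightarrow>
    (\<forall>j i. [b * (b * j + a * i + d) + a * i + d = j] (mod m))"
    by (subst all_comm) (simp only:)
  also have "\<dots> \<longleftrightarrow> m dvd b + 1" by (rule affine_right_symmetric_iff[OF assms])
  finally show ?thesis .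
qed

text \<open>The identity itself says that ab - 1, a + b^2 and (b + 1) d vanish. As ab = 1,
  multiplying the second by a^2 and the third by a gives the stated forms; b^2 and b lead
  back.\<close>

lemma affine_semi_symmetric_iff:
  fixes a b d m :: int
  shows "(\<forall>i j. [a * j + b * (a * i + b * j + d) + d = i] (mod m)) \<longleftrightarrow>
    m dvd a * b - 1 \<and> m dvd a ^ 3 + 1 \<and> m dvd a * d + d"
proof
  assume *: "\<forall>i j. [a * j + b * (a * i + b * j + d) + d = i] (mod m)"
  have k: "m dvd b * d + d" using *[rule_format, of 0 0] by (simp add: cong_iff_dvd_diff)
  have l: "m dvd b * (a + d) + d - 1" using *[rule_format, of 0 1] by (simp add: cong_iff_dvd_diff)
  have n: "m dvd a + b * (b + d) + d" using *[rule_format, of 1 0] by (simp add: cong_iff_dvd_diff)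
  have ab: "m dvd a * b - 1" using dvd_diff[OF l k] by (simp add: algebra_simps)
  have aa: "m dvd a + b * b" using dvd_diff[OF n k] by (simp add: algebra_simps)
  have "a ^ 3 + 1 = a * a * (a + b * b) - (a * b + 1) * (a * b - 1)"
    by (simp add: algebra_simps power3_eq_cube)
  then have "m dvd a ^ 3 + 1"
    using dvd_diff[OF dvd_mult[OF aa] dvd_mult[OF ab]] by (simp only:)
  moreover have "a * d + d = a * (b * d + d) - d * (a * b - 1)" by (simp add: algebra_simps)
  then have "m dvd a * d + d" using dvd_diff[OF dvd_mult[OF k] dvd_mult[OF ab]] by (simp only:)
  ultimately show "m dvd a * b - 1 \<and> m dvd a ^ 3 + 1 \<and> m dvd a * d + d" using ab by simp
next
  assume "m dvd a * b - 1 \<and> m dvd a ^ 3 + 1 \<and> m dvd a * d + d"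
  then have d: "m dvd a * b - 1" "m dvd a ^ 3 + 1" "m dvd a * d + d" by auto
  have "b * d + d = b * (a * d + d) - (a * b - 1) * d" by (simp add: algebra_simps power3_eq_cube)
  then have bd: "m dvd b * d + d"
    using dvd_diff[OF dvd_mult[OF d(3)] dvd_mult2[OF d(1)]] by (simp only:)
  have "a + b * b = b * b * (a ^ 3 + 1) - (a * b - 1) * (a * (a * b + 1))" by (simp add: algebra_simps power3_eq_cube)
  then have aa: "m dvd a + b * b"
    using dvd_diff[OF dvd_mult[OF d(2)] dvd_mult2[OF d(1)]] by (simp only:)
  show "\<forall>i j. [a * j + b * (a * i + b * j + d) + d = i] (mod m)"
  proof (intro allI)
    fix i j
    have "m dvd (a * b - 1) * i + (a + b * b) * j + (b * d + d)"
      by (rule dvd_add[OF dvd_add[OF dvd_mult2[OF d(1)] dvd_mult2[OF aa]] bd])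
    moreover have "(a * b - 1) * i + (a + b * b) * j + (b * d + d) =
      a * j + b * (a * i + b * j + d) + d - i" by (simp add: algebra_simps power3_eq_cube)
    ultimately show "[a * j + b * (a * i + b * j + d) + d = i] (mod m)"
      by (simp add: cong_iff_dvd_diff)
  qed
qed

text \<open>Now the coefficients are a^2 + b, ab - 1 and (a + 1) d, and a (a^2 + b) = a^3 + 1 modulo
  ab = 1. So the inverse three-cycle yields the same condition.\<close>

lemma affine_semi_symmetric_inverse_iff:
  fixes a b d m :: int
  shows "(\<forall>i j. [a * (a * i + b * j + d) + b * i + d = j] (mod m)) \<longleftrightarrow>
    m dvd a * b - 1 \<and> m dvd a ^ 3 + 1 \<and> m dvd a * d + d"
proof
  assume *: "\<forall>i j. [a * (a * i + b * j + d) + b * i + d = j] (mod m)"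
  have k: "m dvd a * d + d" using *[rule_format, of 0 0] by (simp add: cong_iff_dvd_diff)
  have l: "m dvd a * (b + d) + d - 1" using *[rule_format, of 0 1] by (simp add: cong_iff_dvd_diff)
  have n: "m dvd a * (a + d) + b + d" using *[rule_format, of 1 0] by (simp add: cong_iff_dvd_diff)
  have ab: "m dvd a * b - 1" using dvd_diff[OF l k] by (simp add: algebra_simps)
  have aa: "m dvd a * a + b" using dvd_diff[OF n k] by (simp add: algebra_simps)
  have "a ^ 3 + 1 = a * (a * a + b) - (a * b - 1)" by (simp add: algebra_simps power3_eq_cube)
  then have "m dvd a ^ 3 + 1" using dvd_diff[OF dvd_mult[OF aa, of a] ab] by (simp only:)
  then show "m dvd a * b - 1 \<and> m dvd a ^ 3 + 1 \<and> m dvd a * d + d" using k ab by simp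
next
  assume "m dvd a * b - 1 \<and> m dvd a ^ 3 + 1 \<and> m dvd a * d + d"
  then have d: "m dvd a * b - 1" "m dvd a ^ 3 + 1" "m dvd a * d + d" by auto
  have "a * a + b = b * (a ^ 3 + 1) - (a * b - 1) * (a * a)" by (simp add: algebra_simps power3_eq_cube)
  then have aa: "m dvd a * a + b"
    using dvd_diff[OF dvd_mult[OF d(2)] dvd_mult2[OF d(1)]] by (simp only:)
  show "\<forall>i j. [a * (a * i + b * j + d) + b * i + d = j] (mod m)"
  proof (intro allI)
    fix i j
    have "m dvd (a * a + b) * i + (a * b - 1) * j + (a * d + d)"
      by (rule dvd_add[OF dvd_add[OF dvd_mult2[OF aa] dvd_mult2[OF d(1)]] d(3)])
    moreover have "(a * a + b) * i + (a * b - 1) * j + (a * d + d) =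
      a * (a * i + b * j + d) + b * i + d - j" by (simp add: algebra_simps power3_eq_cube)
    ultimately show "[a * (a * i + b * j + d) + b * i + d = j] (mod m)"
      by (simp add: cong_iff_dvd_diff)
  qed
qed

section \<open>Symmetry groups of the canonical isotopes\<close>

text \<open>The last four claims reflect generation in S_3: two transpositions produce the
  three-cycles, and a transposition together with the three-cycles produces everything.\<close>

lemma perms_3_in_Sym_cyclic_isotope:
  fixes m d :: nat and \<alpha> \<beta> :: "int set"
  defines "neg1 \<equiv> \<ominus>\<^bsub>Zmod m\<^esub> \<one>\<^bsub>Zmod m\<^esub>" and "d' \<equiv> residue_class m (int d)"
  assumes T: "(\<alpha>, \<beta>, d) \<in> canonical_triples m"
  defines "f \<equiv> cyclic_isotope_op m \<alpha> \<beta> d"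
  defines "S \<equiv> Sym (carrier (Zmod m)) f"
  defines "semi \<equiv> \<beta> = inv\<^bsub>Zmod m\<^esub> \<alpha> \<and> \<alpha> [^]\<^bsub>Zmod m\<^esub> (3::nat) = neg1 \<and>
    \<alpha> \<otimes>\<^bsub>Zmod m\<^esub> d' = \<ominus>\<^bsub>Zmod m\<^esub> d'"
  shows "id \<in> S" "perm_s \<in> S \<longleftrightarrow> \<alpha> = \<beta>" "perm_l \<in> S \<longleftrightarrow> \<alpha> = neg1" "perm_r \<in> S \<longleftrightarrow> \<beta> = neg1"
    "perm_sr \<in> S \<longleftrightarrow> semi" "perm_rs \<in> S \<longleftrightarrow> semi"
    "\<alpha> = neg1 \<Longrightarrow> \<beta> = neg1 \<Longrightarrow> semi" "semi \<Longrightarrow> \<alpha> = neg1 \<Longrightarrow> \<beta> = neg1"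
    "semi \<Longrightarrow> \<beta> = neg1 \<Longrightarrow> \<alpha> = neg1" "semi \<Longrightarrow> \<alpha> = \<beta> \<Longrightarrow> \<alpha> = neg1"
proof -
  obtain a b where ab: "\<alpha> = residue_class m a" "\<beta> = residue_class m b"
    and cop: "coprime a (int m)" "coprime b (int m)"
    using canonical_triplesE[OF T] by metis
  note e = residue_param_residue_class[of m]
  note op = cyclic_isotope_op_residue_class[of m a b d]
  have Q: "quasigroup (carrier (Zmod m)) f"
    unfolding f_def ab by (rule quasigroup_affine[OF e op cop])
  note S = perms_3_in_Sym[OF Q, folded S_def,
    unfolded residue_param_ball[OF e] f_def ab op residue_class_eq_iff]
  have neg1: "residue_class m x = neg1 \<longleftrightarrow> int m dvd x + 1" for x
    by (simp add: neg1_def residue_class_simps residue_class_eq_iff cong_iff_dvd_diff)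
  have \<alpha>: "\<alpha> = neg1 \<longleftrightarrow> int m dvd a + 1" and \<beta>: "\<beta> = neg1 \<longleftrightarrow> int m dvd b + 1"
    by (simp_all add: ab neg1)
  have \<alpha>\<beta>: "\<alpha> = \<beta> \<longleftrightarrow> int m dvd a - b"
    by (simp add: ab residue_class_eq_iff cong_iff_dvd_diff)
  have semi: "semi \<longleftrightarrow> int m dvd a * b - 1 \<and> int m dvd a ^ 3 + 1 \<and> int m dvd a * int d + int d"
    unfolding semi_def ab d'_def residue_class_inv_iff[OF cop(1)]
    by (simp add: residue_class_simps neg1 residue_class_eq_iff cong_iff_dvd_diff)
  show "id \<in> S" by (rule S(1))
  show "perm_s \<in> S \<longleftrightarrow> \<alpha> = \<beta>" unfolding S(2) \<alpha>\<beta> by (rule affine_commutative_iff)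
  show "perm_l \<in> S \<longleftrightarrow> \<alpha> = neg1" unfolding S(3) \<alpha> by (rule affine_right_symmetric_iff[OF cop(2)])
  show "perm_r \<in> S \<longleftrightarrow> \<beta> = neg1" unfolding S(4) \<beta> by (rule affine_left_symmetric_iff[OF cop(1)])
  show "perm_sr \<in> S \<longleftrightarrow> semi" unfolding S(5) semi by (rule affine_semi_symmetric_iff)
  show "perm_rs \<in> S \<longleftrightarrow> semi" unfolding S(6) semi by (rule affine_semi_symmetric_inverse_iff)
  have cube: "a ^ 3 + 1 = (a + 1) * (a * a - a + 1)" by (simp add: algebra_simps power3_eq_cube)
  have lin: "a * int d + int d = (a + 1) * int d" by (simp add: algebra_simps power3_eq_cube)
  show "semi" if "\<alpha> = neg1" "\<beta> = neg1"
  proof -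
    have *: "int m dvd a + 1" "int m dvd b + 1" using that \<alpha> \<beta> by auto
    have "a * b - 1 = (a + 1) * b - (b + 1)" by (simp add: algebra_simps power3_eq_cube)
    then have "int m dvd a * b - 1"
      using dvd_diff[OF dvd_mult2[OF *(1)] *(2)] by (simp only:)
    then show ?thesis unfolding semi cube lin using * by simp
  qed
  show "\<beta> = neg1" if "semi" "\<alpha> = neg1"
  proof -
    have "int m dvd a + 1" "int m dvd a * b - 1" using that \<alpha> semi by simp_all
    from dvd_diff[OF dvd_mult2[OF this(1), of b] this(2)] show ?thesis
      unfolding \<beta> by (simp add: algebra_simps)
  qed
  show "\<alpha> = neg1" if "semi" "\<beta> = neg1"
  proof -
    have "int m dvd b + 1" "int m dvd a * b - 1" using that \<beta> semi by simp_all
    from dvd_diff[OF dvd_mult[OF this(1), of a] this(2)] show ?thesis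
      unfolding \<alpha> by (simp add: algebra_simps)
  qed
  show "\<alpha> = neg1" if "semi" "\<alpha> = \<beta>"
  proof -
    have *: "int m dvd a - b" "int m dvd a * b - 1" "int m dvd a ^ 3 + 1"
      using that \<alpha>\<beta> semi by simp_all
    \<comment> \<open>With a = b, the cube a^3 is a (a b), and ab = 1 reduces it to a; the two
      subtracted terms record these replacements.\<close>
    have "a + 1 = a ^ 3 + 1 - a * (a * b - 1) - a * a * (a - b)"
      by (simp add: algebra_simps power3_eq_cube)
    then show ?thesis
      unfolding \<alpha> using dvd_diff[OF dvd_diff[OF *(3) dvd_mult[OF *(2)]] dvd_mult[OF *(1)]]
      by (simp only:)
  qed
qed

lemma cyclic_isotope_symmetries:
  fixes m d :: nat and \<alpha> \<beta> :: "int set"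
  assumes T: "(\<alpha>, \<beta>, d) \<in> canonical_triples m"
  defines "Q \<equiv> carrier (Zmod m)" and "f \<equiv> cyclic_isotope_op m \<alpha> \<beta> d"
  defines "neg1 \<equiv> \<ominus>\<^bsub>Zmod m\<^esub> \<one>\<^bsub>Zmod m\<^esub>" and "d' \<equiv> residue_class m (int d)"
  defines "semi \<equiv> \<beta> = inv\<^bsub>Zmod m\<^esub> \<alpha> \<and> \<alpha> [^]\<^bsub>Zmod m\<^esub> (3::nat) = neg1 \<and>
    \<alpha> \<otimes>\<^bsub>Zmod m\<^esub> d' = \<ominus>\<^bsub>Zmod m\<^esub> d'"
  shows "linear_isotope (add_monoid (Zmod m)) f"
    and "strictly commutative_qg Q f \<longleftrightarrow> \<beta> = \<alpha> \<and> \<alpha> \<noteq> neg1"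
    and "Sym Q f = {id, perm_s} \<longleftrightarrow> \<beta> = \<alpha> \<and> \<alpha> \<noteq> neg1"
    and "strictly left_symmetric Q f \<longleftrightarrow> \<beta> = neg1 \<and> neg1 \<noteq> \<alpha>"
    and "Sym Q f = {id, perm_r} \<longleftrightarrow> \<beta> = neg1 \<and> neg1 \<noteq> \<alpha>"
    and "strictly right_symmetric Q f \<longleftrightarrow> \<alpha> = neg1 \<and> neg1 \<noteq> \<beta>"
    and "Sym Q f = {id, perm_l} \<longleftrightarrow> \<alpha> = neg1 \<and> neg1 \<noteq> \<beta>"
    and "strictly semi_symmetric Q f \<longleftrightarrow> \<alpha> \<noteq> neg1 \<and> semi"
    and "Sym Q f = carrier (alt_group 3) \<longleftrightarrow> \<alpha> \<noteq> neg1 \<and> semi"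
    and "totally_symmetric Q f \<longleftrightarrow> \<alpha> = neg1 \<and> \<beta> = neg1"
    and "asymmetric_qg Q f \<longleftrightarrow> \<alpha> \<noteq> neg1 \<and> \<alpha> \<noteq> \<beta> \<and> \<beta> \<noteq> neg1 \<and> \<not> semi"
proof -
  show "linear_isotope (add_monoid (Zmod m)) f"
    
    unfolding f_def by (rule canonical_triplesE[OF T], hypsubst) (rule linear_isotope_add_monoid)
  have distinct: "id \<noteq> perm_s" "id \<noteq> perm_l" "id \<noteq> perm_r" "id \<noteq> perm_sr" "id \<noteq> perm_rs"
    "perm_s \<noteq> perm_l" "perm_s \<noteq> perm_r" "perm_s \<noteq> perm_sr" "perm_s \<noteq> perm_rs"
    "perm_l \<noteq> perm_r" "perm_l \<noteq> perm_sr" "perm_l \<noteq> perm_rs"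
    "perm_r \<noteq> perm_sr" "perm_r \<noteq> perm_rs" "perm_sr \<noteq> perm_rs"
    using perms_3_distinct
    by (simp_all only: distinct.simps list.set insert_iff empty_iff de_Morgan_disj simp_thms)
  note mem = perms_3_in_Sym_cyclic_isotope[OF T, folded Q_def f_def neg1_def d'_def, folded semi_def]
  have sub: "carrier (sym_group 3) \<subseteq> carrier (sym_group 3)"
    "carrier (alt_group 3) \<subseteq> carrier (sym_group 3)" "{id} \<subseteq> carrier (sym_group 3)"
    "{id, perm_s} \<subseteq> carrier (sym_group 3)" "{id, perm_l} \<subseteq> carrier (sym_group 3)"
    "{id, perm_r} \<subseteq> carrier (sym_group 3)"
    unfolding carrier_sym_group_3 carrier_alt_group_3 by blast+
  note eq = sub[THEN Sym_eq_iff, of Q f, unfolded carrier_sym_group_3 carrier_alt_group_3]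
  \<comment> \<open>Distinctness in both orientations lets the simplifier decide which of the six
    permutations lie in an explicit set; \<open>mem\<close> then leaves a propositional formula in
    the conditions on \<alpha> and \<beta>.\<close>
  note simps = ball_simps insert_iff empty_iff distinct distinct[THEN not_sym] mem(1-6) simp_thms
  show total: "totally_symmetric Q f \<longleftrightarrow> \<alpha> = neg1 \<and> \<beta> = neg1"
    unfolding totally_symmetric_def carrier_sym_group_3
    by (simp only: eq(1) simps) (use mem(1,7) in blast)
  show "strictly commutative_qg Q f \<longleftrightarrow> \<beta> = \<alpha> \<and> \<alpha> \<noteq> neg1"
    unfolding strictly_def total commutative_qg_def mem by blast
  show "strictly left_symmetric Q f \<longleftrightarrow> \<beta> = neg1 \<and> neg1 \<noteq> \<alpha>"
    unfolding strictly_def total left_symmetric_def mem by blast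
  show "strictly right_symmetric Q f \<longleftrightarrow> \<alpha> = neg1 \<and> neg1 \<noteq> \<beta>"
    unfolding strictly_def total right_symmetric_def mem by blast
  show "strictly semi_symmetric Q f \<longleftrightarrow> \<alpha> \<noteq> neg1 \<and> semi"
    unfolding strictly_def total semi_symmetric_def carrier_alt_group_3 insert_subset mem(1,5,6)
    using mem(1,8) by blast
  show "Sym Q f = {id, perm_s} \<longleftrightarrow> \<beta> = \<alpha> \<and> \<alpha> \<noteq> neg1"
    by (simp only: eq(4) simps) (use mem(1,7-10) in blast)
  show "Sym Q f = {id, perm_r} \<longleftrightarrow> \<beta> = neg1 \<and> neg1 \<noteq> \<alpha>"
    by (simp only: eq(6) simps) (use mem(1,7-10) in blast)
  show "Sym Q f = {id, perm_l} \<longleftrightarrow> \<alpha> = neg1 \<and> neg1 \<noteq> \<beta>"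
    by (simp only: eq(5) simps) (use mem(1,7-10) in blast)
  show "Sym Q f = carrier (alt_group 3) \<longleftrightarrow> \<alpha> \<noteq> neg1 \<and> semi"
    unfolding carrier_alt_group_3
    by (simp only: eq(2) simps) (use mem(1,7-10) in blast)
  show "asymmetric_qg Q f \<longleftrightarrow> \<alpha> \<noteq> neg1 \<and> \<alpha> \<noteq> \<beta> \<and> \<beta> \<noteq> neg1 \<and> \<not> semi"
    unfolding asymmetric_qg_def
    by (simp only: eq(3) simps) (use mem(1,7-10) in blast)
qed

theorem corollary16:
  fixes m :: nat
  assumes "0 < m"
  shows
    "(\<forall>(G :: ('a, 'b) monoid_scheme) f.
        group G \<and> cyclic_group G \<and> order G = m \<and> linear_isotope G f \<longrightarrow>
        (\<exists>!(\<alpha>, \<beta>, d) \<in> canonical_triples m.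
           quasigroup_isomorphic (carrier G) f (carrier (Zmod m)) (cyclic_isotope_op m \<alpha> \<beta> d)))
     \<and>
     (\<forall>(\<alpha>, \<beta>, d) \<in> canonical_triples m.
        let R = Zmod m; Q = carrier R; f = cyclic_isotope_op m \<alpha> \<beta> d; neg1 = \<ominus>\<^bsub>R\<^esub> \<one>\<^bsub>R\<^esub>;
            d' = residue_class m (int d)
        in
          linear_isotope (add_monoid R) f
          \<and> (strictly commutative_qg Q f \<longleftrightarrow> \<beta> = \<alpha> \<and> \<alpha> \<noteq> neg1)
          \<and> (Sym Q f = {id, perm_s} \<longleftrightarrow> \<beta> = \<alpha> \<and> \<alpha> \<noteq> neg1)
          \<and> (strictly left_symmetric Q f \<longleftrightarrow> \<beta> = neg1 \<and> neg1 \<noteq> \<alpha>)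
          \<and> (Sym Q f = {id, perm_r} \<longleftrightarrow> \<beta> = neg1 \<and> neg1 \<noteq> \<alpha>)
          \<and> (strictly right_symmetric Q f \<longleftrightarrow> \<alpha> = neg1 \<and> neg1 \<noteq> \<beta>)
          \<and> (Sym Q f = {id, perm_l} \<longleftrightarrow> \<alpha> = neg1 \<and> neg1 \<noteq> \<beta>)
          \<and> (strictly semi_symmetric Q f \<longleftrightarrow>
               \<alpha> \<noteq> neg1 \<and> \<beta> = inv\<^bsub>R\<^esub> \<alpha> \<and> \<alpha> [^]\<^bsub>R\<^esub> (3::nat) = neg1 \<and> \<alpha> \<otimes>\<^bsub>R\<^esub> d' = \<ominus>\<^bsub>R\<^esub> d')
          \<and> (Sym Q f = carrier (alt_group 3) \<longleftrightarrow>
               \<alpha> \<noteq> neg1 \<and> \<beta> = inv\<^bsub>R\<^esub> \<alpha> \<and> \<alpha> [^]\<^bsub>R\<^esub> (3::nat) = neg1 \<and> \<alpha> \<otimes>\<^bsub>R\<^esub> d' = \<ominus>\<^bsub>R\<^esub> d')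
          \<and> (totally_symmetric Q f \<longleftrightarrow> \<alpha> = neg1 \<and> \<beta> = neg1)
          \<and> (asymmetric_qg Q f \<longleftrightarrow>
               \<alpha> \<noteq> neg1 \<and> \<alpha> \<noteq> \<beta> \<and> \<beta> \<noteq> neg1 \<and>
               (\<beta> \<noteq> inv\<^bsub>R\<^esub> \<alpha> \<or> \<alpha> [^]\<^bsub>R\<^esub> (3::nat) \<noteq> neg1 \<or> \<alpha> \<otimes>\<^bsub>R\<^esub> d' \<noteq> \<ominus>\<^bsub>R\<^esub> d')))"


proof (intro conjI allI impI)
  fix G :: "('a, 'b) monoid_scheme" and f
  assume "group G \<and> cyclic_group G \<and> order G = m \<and> linear_isotope G f"
  then have G: "group G" "cyclic_group G" "order G = m" and f: "linear_isotope G f" by auto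
  obtain g where g: "g \<in> carrier G" and e: "residue_param (int m) (\<lambda>i::int. g [^]\<^bsub>G\<^esub> i) (carrier G)"
    using cyclic_group_residue_param[OF G assms] by blast
  obtain a b c where ab: "coprime a (int m)" "coprime b (int m)"
    and fabc: "\<And>i j. f (g [^]\<^bsub>G\<^esub> i) (g [^]\<^bsub>G\<^esub> j) = g [^]\<^bsub>G\<^esub> (a * i + b * j + c)"
    using linear_isotope_cyclic_group_affine[OF G(1) g e f] by blast
  show "\<exists>!(\<alpha>, \<beta>, d) \<in> canonical_triples m.
      quasigroup_isomorphic (carrier G) f (carrier (Zmod m)) (cyclic_isotope_op m \<alpha> \<beta> d)"
    by (rule ex1_isomorphic_cyclic_isotope[OF e assms fabc ab])
\<comment> \<open>\<open>de_Morgan_conj\<close> matches the negated conjunction in the lemma with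
  the disjunction in the asymmetry clause.\<close>
qed (unfold Let_def, intro ballI case_prodI2 conjI;
    simp only: cyclic_isotope_symmetries de_Morgan_conj)

end
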